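(* For every integer $n\ge 7$, $$\mathrm{ex}_{\mathcal{OP}}(n,P_3^{\mathrm{ind}},\emptyset)=\binom{n-1}{2}.$$ Moreover, an $n$-vertex outerplanar graph $G$ attains equality (contains exactly $\binom{n-1}{2}$ induced copies of $P_3$) only when $G$ is a star. For $n=4$, the extremal graph is the cycle on 4 vertices, which contains $4$ induced copies of $P_3$. For $n=5$, the extremal graph is the cycle (on 4 vertices) with one pendant leaf, which contains $6$ induced copies of $P_3$. For $n=6$, the extremal graph is the star or a $C_6$ with one chord joining opposite vertices, which contains $10$ induced copies of $P_3$.
   Context: All graphs are finite and simple. $P_k$ denotes the path with $k$ vertices and $C_k$ the cycle with $k$ vertices. A graph is outerplanar if it has a planar drawing in which all vertices belong to the outer face. An induced copy of a graph $H$ in a graph $G$ is a vertex subset $S\subseteq V(G)$ such that the induced subgraph $G[S]$ is isomorphic to $H$. $\mathrm{ex}_{\mathcal{OP}}(n,H^{\mathrm{ind}},\emptyset)$ denotes the maximum number of induced copies of $H$ over all $n$-vertex outerplanar graphs; an extremal graph for $n$ is an $n$-vertex outerplanar graph attaining $\mathrm{ex}_{\mathcal{OP}}(n,P_3^{\mathrm{ind}},\emptyset)$. A star on $n$ vertices is $K_{1,n-1}$.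
   Formalization: For n=5 the cycle on 4 vertices with a pendant leaf is not the only extremal graph: the star K_{1,4} and C_5 with one chord also contain 6 induced copies of P_3; the formal statement lists exactly these three extremal graphs. *)

theory Defs
  imports "HOL-Analysis.Analysis" "Graph_Theory.Graph_Theory"
begin

text \<open>
  A finite simple graph is a \<^const>\<open>pair_graph\<close>: a finite loop-free digraph without parallel
  arcs whose arc relation is symmetric, so that an edge uv is the pair of arcs (u,v), (v,u).
\<close>

definition path_graph :: "nat \<Rightarrow> nat pair_pre_digraph" where
  "path_graph k = \<lparr> pverts = {..<k},
     parcs = {(i, j). i < k \<and> j < k \<and> (j = Suc i \<or> i = Suc j)} \<rparr>"

text \<open>Meant for k at least 3.\<close>
definition cycle_graph :: "nat \<Rightarrow> nat pair_pre_digraph" where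
  "cycle_graph k = \<lparr> pverts = {..<k},
     parcs = {(i, j). i < k \<and> j < k \<and> (j = Suc i mod k \<or> i = Suc j mod k)} \<rparr>"

definition insert_edge :: "'a \<Rightarrow> 'a \<Rightarrow> 'a pair_pre_digraph \<Rightarrow> 'a pair_pre_digraph" where
  "insert_edge u v G = \<lparr> pverts = {u, v} \<union> pverts G, parcs = {(u, v), (v, u)} \<union> parcs G \<rparr>"

abbreviation graph_iso :: "'a pair_pre_digraph \<Rightarrow> 'b pair_pre_digraph \<Rightarrow> bool" where
  "graph_iso G H \<equiv> digraph_iso (with_proj G) (with_proj H)"

abbreviation is_star :: "nat \<Rightarrow> 'a pair_pre_digraph \<Rightarrow> bool" where
  "is_star n G \<equiv> complete_bipartite_digraph 1 (n - 1) (with_proj G)"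

text \<open>
  In a drawing given by \<open>p\<close> and \<open>c\<close>, the vertex v is the point \<open>p v\<close> of the plane and the edge uv
  is the simple arc \<open>c {u, v}\<close>, traversed in either direction. An arc meets the vertex points only
  in its two endpoints, and two arcs meet only in the point of a common end vertex.
\<close>
definition planar_drawing ::
    "'a pair_pre_digraph \<Rightarrow> ('a \<Rightarrow> complex) \<Rightarrow> ('a set \<Rightarrow> real \<Rightarrow> complex) \<Rightarrow> bool" where
  "planar_drawing G p c \<longleftrightarrow>
     inj_on p (pverts G) \<and>
     (\<forall>(u, v) \<in> parcs G. arc (c {u, v}) \<and>
        {pathstart (c {u, v}), pathfinish (c {u, v})} = {p u, p v} \<and>
        path_image (c {u, v}) \<inter> p ` pverts G = {p u, p v}) \<and>
     (\<forall>(u, v) \<in> parcs G. \<forall>(x, y) \<in> parcs G. {u, v} \<noteq> {x, y} \<longrightarrow>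
        path_image (c {u, v}) \<inter> path_image (c {x, y}) \<subseteq> p ` ({u, v} \<inter> {x, y}))"

definition drawing_image ::
    "'a pair_pre_digraph \<Rightarrow> ('a \<Rightarrow> complex) \<Rightarrow> ('a set \<Rightarrow> real \<Rightarrow> complex) \<Rightarrow> complex set" where
  "drawing_image G p c = p ` pverts G \<union> (\<Union>(u, v) \<in> parcs G. path_image (c {u, v}))"

text \<open>
  The drawing is a compact subset D of the plane, so \<^term>\<open>outside D\<close> is the unique unbounded
  component of its complement, the (open) outer face. A vertex belongs to the outer face if it
  lies on its boundary.
\<close>
definition outerplanar :: "'a pair_pre_digraph \<Rightarrow> bool" where
  "outerplanar G \<longleftrightarrow> pair_graph G \<and>
     (\<exists>p c. planar_drawing G p c \<and> p ` pverts G \<subseteq> frontier (outside (drawing_image G p c)))"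

definition ind_copies :: "'b pair_pre_digraph \<Rightarrow> 'a pair_pre_digraph \<Rightarrow> nat" where
  "ind_copies H G =
     card {S. S \<subseteq> pverts G \<and> digraph_iso (induce_subgraph (with_proj G) S) (with_proj H)}"

text \<open>
  Taking vertices of type \<^typ>\<open>nat\<close> loses nothing, since every finite graph is isomorphic to one
  on natural numbers. The set of counts is nonempty (edgeless graphs) and bounded by \<open>2 ^ n\<close>.
\<close>
definition ex_OP :: "nat \<Rightarrow> 'b pair_pre_digraph \<Rightarrow> nat" where
  "ex_OP n H =
     Max {ind_copies H G |G :: nat pair_pre_digraph. outerplanar G \<and> card (pverts G) = n}"

definition extremal :: "nat \<Rightarrow> 'a pair_pre_digraph \<Rightarrow> bool" where
  "extremal n G \<longleftrightarrow> outerplanar G \<and> card (pverts G) = n \<and>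
     ind_copies (path_graph 3) G = ex_OP n (path_graph 3)"

end

theory Submission
  imports Defs "HOL-Library.Sublist" "HOL-Library.Multiset"
begin

text \<open>
  The outer face enters the proof through one fact about arcs: if three arcs join two points
  and are otherwise disjoint, then one of them runs inside the closed curve formed by the other
  two (\<open>theta_curve\<close>). No vertex of an outerplanar drawing lies inside a closed curve of the
  drawing, so two configurations are excluded. Three internally disjoint paths between two
  vertices cannot all have an inner vertex (\<open>theta_free\<close>). If two chords of a cycle had
  alternating ends, then both would run inside the cycle, and there they would meet
  (\<open>crossing_free\<close>). The combinatorial part uses only these two exclusions; they speak of paths
  and cycles, not of induced ones, and are therefore inherited by every vertex subset, so that
  all counts can be taken on subsets of a fixed adjacency relation.

  The upper bound is an induction that deletes one vertex. Since \<open>(n - 1) choose 2\<close> and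
  \<open>(n - 2) choose 2\<close> differ by \<open>n - 2\<close>, what is needed is a vertex in at most \<open>n - 2\<close> copies. A
  longest path shows that some vertex v has degree at most two (\<open>low_degree_vertex\<close>). If v has
  at most one neighbour, or two adjacent ones, the bound is immediate, because two vertices
  have at most two common neighbours. If v has two nonadjacent neighbours u and w, it can fail
  by one only when every further vertex is adjacent to u or w and exactly one of them, x, to
  both. Then the same longest path argument, run inside the neighbourhood of u or w with the edge
  to x held fixed, gives another vertex of degree at most two whose neighbours are adjacent
  (\<open>removable_vertex\<close>). This works from five vertices on; the four-cycle, with 4 copies
  instead of 3, is the exception below.

  On five vertices, a vertex of degree at most two added to a four-cycle or a star gives the
  three extremal configurations: a four-cycle with a pendant vertex, a five-cycle with a chord,
  and a star. From then on, equality forces equality in the smaller set and exactly \<open>n - 2\<close> copies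
  through the deleted vertex. Besides the star, the only such extension to six vertices is the
  six-cycle with a long chord, which cannot be extended to seven; a star extends only to a
  star (\<open>extremal_star\<close>).

  In the other direction the extremal graphs are drawn with straight edges on a parabola
  (\<open>outerplanar_if_noncrossing\<close>): the region above the parabola is convex, so the outside of the
  drawing touches every vertex.
\<close>

section \<open>Arcs in the plane\<close>

lemma connected_subset_inside:
  fixes S C :: "complex set"
  assumes "topological_space_class.connected C" "C \<inter> S = {}" "C \<inter> inside S \<noteq> {}"
  shows "C \<subseteq> inside S"
proof
  fix y assume y: "y \<in> C"
  from assms(3) obtain x where x: "x \<in> C" "x \<in> inside S" by auto
  have "connected_component (- S) x y"
    unfolding connected_component_def using assms(1,2) x(1) y by blast
  then show "y \<in> inside S" using x(2) by (rule inside_same_component)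
qed

text \<open>
  Suppose that each arc avoids the inside of the other two. The inside of \<open>g1\<close> and \<open>g2\<close> is then
  disjoint from the insides of the other two closed curves, since nested insides would coincide
  and so would their frontiers. Hence neither of the closed curves through \<open>g3\<close> separates a point x
  inside \<open>g1\<close> and \<open>g2\<close> from a point y far away. These two curves meet in \<open>g3\<close>, which is connected,
  so by Janiszewski's theorem their union does not separate x from y either; but it contains
  \<open>g1\<close> and \<open>g2\<close>.
\<close>
lemma theta_curve:
  fixes g1 g2 g3 :: "real \<Rightarrow> complex"
  assumes arcs: "arc g1" "arc g2" "arc g3"
    and ends: "pathstart g1 = a" "pathfinish g1 = b" "pathstart g2 = a" "pathfinish g2 = b"
      "pathstart g3 = a" "pathfinish g3 = b"
    and meet: "path_image g1 \<inter> path_image g2 = {a, b}" "path_image g1 \<inter> path_image g3 = {a, b}"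
      "path_image g2 \<inter> path_image g3 = {a, b}"
  shows "path_image g1 - {a, b} \<subseteq> inside (path_image g2 \<union> path_image g3) \<or>
         path_image g2 - {a, b} \<subseteq> inside (path_image g1 \<union> path_image g3) \<or>
         path_image g3 - {a, b} \<subseteq> inside (path_image g1 \<union> path_image g2)"
proof (rule ccontr)
  let ?G1 = "path_image g1" and ?G2 = "path_image g2" and ?G3 = "path_image g3"
  let ?I12 = "inside (?G1 \<union> ?G2)" and ?I13 = "inside (?G1 \<union> ?G3)" and ?I23 = "inside (?G2 \<union> ?G3)"
  assume neg: "\<not> ?thesis"
  have con: "topological_space_class.connected (?G1 - {a, b})" "topological_space_class.connected (?G2 - {a, b})" "topological_space_class.connected (?G3 - {a, b})"
    using connected_simple_path_endless arc_imp_simple_path arcs ends by metis+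
  have ne: "?G1 - {a, b} \<noteq> {}" "?G2 - {a, b} \<noteq> {}" "?G3 - {a, b} \<noteq> {}"
    using nonempty_simple_path_endless arc_imp_simple_path arcs ends by metis+
  have ab: "a \<in> ?G1" "b \<in> ?G1" "a \<in> ?G2" "b \<in> ?G2" "a \<in> ?G3" "b \<in> ?G3"
    using meet by auto
  have key: "G \<inter> inside S = {}"
    if G: "topological_space_class.connected (G - {a, b})" "G \<inter> S = {a, b}" "\<not> G - {a, b} \<subseteq> inside S" for G S
  proof -
    have "(G - {a, b}) \<inter> S = {}" using G(2) by auto
    then have "(G - {a, b}) \<inter> inside S = {}"
      using connected_subset_inside[OF G(1)] G(3) by blast
    moreover have "{a, b} \<inter> inside S = {}"
      using G(2) inside_no_overlap[of S] by blast
    ultimately show ?thesis by auto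
  qed
  have d1: "?G1 \<inter> ?I23 = {}"
    by (rule key[OF con(1)]) (use neg meet in auto)
  have d2: "?G2 \<inter> ?I13 = {}"
    by (rule key[OF con(2)]) (use neg meet in auto)
  have d3: "?G3 \<inter> ?I12 = {}"
    by (rule key[OF con(3)]) (use neg meet in auto)
  have sp: "simple_path (g1 +++ reversepath g2)" "simple_path (g1 +++ reversepath g3)"
    "simple_path (g2 +++ reversepath g3)"
    using arcs ends meet by (auto simp: simple_path_join_loop_eq arc_reversepath)
  have im: "path_image (g1 +++ reversepath g2) = ?G1 \<union> ?G2" "path_image (g1 +++ reversepath g3) = ?G1 \<union> ?G3"
    "path_image (g2 +++ reversepath g3) = ?G2 \<union> ?G3"
    using ends by (auto simp: path_image_join)
  have cl: "pathfinish (g1 +++ reversepath g2) = pathstart (g1 +++ reversepath g2)"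
     "pathfinish (g1 +++ reversepath g3) = pathstart (g1 +++ reversepath g3)"
     "pathfinish (g2 +++ reversepath g3) = pathstart (g2 +++ reversepath g3)"
    using ends by auto
  note J12 = Jordan_inside_outside[OF sp(1) cl(1), unfolded im]
  note J13 = Jordan_inside_outside[OF sp(2) cl(2), unfolded im]
  note J23 = Jordan_inside_outside[OF sp(3) cl(3), unfolded im]
  have "?G1 \<union> ?G2 \<noteq> ?G1 \<union> ?G3" "?G1 \<union> ?G2 \<noteq> ?G2 \<union> ?G3"
    using ne meet by blast+
  then have diff: "?I12 \<noteq> ?I13" "?I12 \<noteq> ?I23"
    using J12 J13 J23 by metis+
  have dis13: "?I12 \<inter> ?I13 = {}"
  proof (rule ccontr)
    assume m: "?I12 \<inter> ?I13 \<noteq> {}"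
    have "?I12 \<subseteq> ?I13"
      using m d3 inside_no_overlap[of "?G1 \<union> ?G2"] J12 by (intro connected_subset_inside) blast+
    moreover have "?I13 \<subseteq> ?I12"
      using m d2 inside_no_overlap[of "?G1 \<union> ?G3"] J13 by (intro connected_subset_inside) blast+
    ultimately show False using diff by auto
  qed
  have dis23: "?I12 \<inter> ?I23 = {}"
  proof (rule ccontr)
    assume m: "?I12 \<inter> ?I23 \<noteq> {}"
    have "?I12 \<subseteq> ?I23"
      using m d3 inside_no_overlap[of "?G1 \<union> ?G2"] J12 by (intro connected_subset_inside) blast+
    moreover have "?I23 \<subseteq> ?I12"
      using m d1 inside_no_overlap[of "?G2 \<union> ?G3"] J23 by (intro connected_subset_inside) blast+
    ultimately show False using diff by auto
  qed
  obtain x where x: "x \<in> ?I12" using J12 by auto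
  have cpt: "compact ?G1" "compact ?G2" "compact ?G3"
    using arcs by (auto simp: compact_arc_image)
  have bnd: "bounded (?G1 \<union> ?G2 \<union> ?G3)" using cpt by (simp add: compact_imp_bounded)
  have "\<not> bounded (outside (?G1 \<union> ?G2 \<union> ?G3))" using bnd by (simp add: unbounded_outside)
  then obtain y where y: "y \<in> outside (?G1 \<union> ?G2 \<union> ?G3)" by fastforce
  have y': "y \<in> outside (?G1 \<union> ?G2)" "y \<in> outside (?G1 \<union> ?G3)" "y \<in> outside (?G2 \<union> ?G3)"
    using y outside_mono[of _ "?G1 \<union> ?G2 \<union> ?G3"] by blast+
  have x13: "x \<in> outside (?G1 \<union> ?G3)" "x \<in> outside (?G2 \<union> ?G3)"
    using x dis13 dis23 d3 inside_Un_outside[of "?G1 \<union> ?G3"] inside_Un_outside[of "?G2 \<union> ?G3"]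
      inside_no_overlap[of "?G1 \<union> ?G2"] by blast+
  have c13: "connected_component (- (?G1 \<union> ?G3)) x y"
    by (rule connected_componentI[of "outside (?G1 \<union> ?G3)"])
      (use J13 x13 y' outside_no_overlap[of "?G1 \<union> ?G3"] in \<open>simp_all only: disjoint_eq_subset_Compl simp_thms\<close>)
  have c23: "connected_component (- (?G2 \<union> ?G3)) x y"
    by (rule connected_componentI[of "outside (?G2 \<union> ?G3)"])
      (use J23 x13 y' outside_no_overlap[of "?G2 \<union> ?G3"] in \<open>simp_all only: disjoint_eq_subset_Compl simp_thms\<close>)
  have "(?G1 \<union> ?G3) \<inter> (?G2 \<union> ?G3) = ?G3" using meet ab by blast
  then have con3: "topological_space_class.connected ((?G1 \<union> ?G3) \<inter> (?G2 \<union> ?G3))"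
    using arcs by (simp add: connected_arc_image)
  have "compact (?G1 \<union> ?G3)" "closed (?G2 \<union> ?G3)"
    using cpt by (auto simp: compact_imp_closed closed_Un)
  from Janiszewski[OF this con3 c13 c23]
  have "connected_component (- ((?G1 \<union> ?G3) \<union> (?G2 \<union> ?G3))) x y" .
  then have "connected_component (- (?G1 \<union> ?G2)) x y"
    by (rule connected_component_of_subset) blast
  then have "y \<in> ?I12" using x by (rule inside_same_component)
  then show False using y'(1) inside_Int_outside by blast
qed

lemma arc_subset_closure_endless:
  fixes g :: "real \<Rightarrow> complex"
  assumes "arc g"
  shows "path_image g \<subseteq> closure (path_image g - {pathstart g, pathfinish g})"
proof -
  have "continuous_on {0..1} g" using assms by (simp add: arc_def path_def)
  then have "g ` closure {0<..<1} \<subseteq> closure (g ` {0<..<1})"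
    by (intro image_closure_subset) (auto simp: closure_subset)
  then show ?thesis
    using simple_path_endless[OF arc_imp_simple_path[OF assms]] by (simp add: path_image_def)
qed

text \<open>
  The arc \<open>e\<close> cuts the inside of the closed curve into two parts. If \<open>f\<close> missed \<open>e\<close>, its connected
  interior would stay in one part, whose closure contains only one of the ends of \<open>f\<close>.
\<close>
lemma chords_inside_closed_curve_meet:
  fixes g1 g2 e f :: "real \<Rightarrow> complex"
  assumes arcs: "arc g1" "arc g2" "arc e" "arc f"
    and ends: "pathstart g1 = a" "pathfinish g1 = c" "pathstart g2 = a" "pathfinish g2 = c"
      "pathstart e = a" "pathfinish e = c" "pathstart f = b" "pathfinish f = d"
    and meet: "path_image g1 \<inter> path_image g2 = {a, c}" "path_image g1 \<inter> path_image e = {a, c}"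
      "path_image g2 \<inter> path_image e = {a, c}"
    and e_in: "path_image e - {a, c} \<subseteq> inside (path_image g1 \<union> path_image g2)"
    and f_in: "path_image f - {b, d} \<subseteq> inside (path_image g1 \<union> path_image g2)"
    and b: "b \<in> path_image g1 - {a, c}" and d: "d \<in> path_image g2 - {a, c}"
  shows "path_image e \<inter> path_image f \<noteq> {}"
proof
  let ?G1 = "path_image g1" and ?G2 = "path_image g2" and ?E = "path_image e" and ?F = "path_image f"
  assume ef: "?E \<inter> ?F = {}"
  have ac: "a \<noteq> c" using arcs(1) ends arc_distinct_ends by metis
  have "?E - {a, c} \<noteq> {}"
    using nonempty_simple_path_endless arc_imp_simple_path arcs ends by metis
  then have "?E \<inter> inside (?G1 \<union> ?G2) \<noteq> {}" using e_in by blast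
  then obtain dis: "inside (?G1 \<union> ?E) \<inter> inside (?G2 \<union> ?E) = {}"
    and un: "inside (?G1 \<union> ?E) \<union> inside (?G2 \<union> ?E) \<union> (?E - {a, c}) = inside (?G1 \<union> ?G2)"
    using split_inside_simple_closed_curve[of g1 a c g2 e] arcs ends meet ac
    by (metis arc_imp_simple_path)
  have cl: "closed (?G1 \<union> ?E)" "closed (?G2 \<union> ?E)"
    using arcs by (auto simp: closed_arc_image closed_Un)
  then have op: "open (inside (?G1 \<union> ?E))" "open (inside (?G2 \<union> ?E))"
    by (auto intro: open_inside)
  have con: "topological_space_class.connected (?F - {b, d})"
    using connected_simple_path_endless arc_imp_simple_path arcs ends by metis
  have "?F \<subseteq> closure (?F - {b, d})"
    using arc_subset_closure_endless[OF arcs(4)] ends by simp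
  then have bd: "b \<in> closure (?F - {b, d})" "d \<in> closure (?F - {b, d})"
    using ends by (metis pathstart_in_path_image subsetD, metis pathfinish_in_path_image subsetD)
  have sub: "?F - {b, d} \<subseteq> inside (?G1 \<union> ?E) \<union> inside (?G2 \<union> ?E)"
    using f_in un ef by blast
  have "inside (?G1 \<union> ?E) \<inter> (?F - {b, d}) = {} \<or> inside (?G2 \<union> ?E) \<inter> (?F - {b, d}) = {}"
    using connectedD[OF con op _ sub] dis by blast
  then consider "?F - {b, d} \<subseteq> inside (?G1 \<union> ?E)" | "?F - {b, d} \<subseteq> inside (?G2 \<union> ?E)"
    using sub by blast
  then show False
  proof cases
    case 1
    then have "d \<in> (?G1 \<union> ?E) \<union> inside (?G1 \<union> ?E)"
      using bd closure_mono closure_inside_subset[OF cl(1)] by blast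
    moreover have "d \<notin> ?G1 \<union> ?E" using d meet by blast
    ultimately have "d \<in> inside (?G1 \<union> ?G2)" using un by blast
    then show False using d inside_no_overlap[of "?G1 \<union> ?G2"] by blast
  next
    case 2
    then have "b \<in> (?G2 \<union> ?E) \<union> inside (?G2 \<union> ?E)"
      using bd closure_mono closure_inside_subset[OF cl(2)] by blast
    moreover have "b \<notin> ?G2 \<union> ?E" using b meet by blast
    ultimately have "b \<in> inside (?G1 \<union> ?G2)" using un by blast
    then show False using b inside_no_overlap[of "?G1 \<union> ?G2"] by blast
  qed
qed

section \<open>Cycles and paths in an outerplanar drawing\<close>

fun path_edges :: "'a list \<Rightarrow> 'a set set" where
  "path_edges (x # y # zs) = insert {x, y} (path_edges (y # zs))"
| "path_edges _ = {}"

lemma path_edges_append: "path_edges (xs @ y # ys) = path_edges (xs @ [y]) \<union> path_edges (y # ys)"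
  by (induction xs rule: path_edges.induct) (auto split: list.splits, (case_tac ys; auto)?)

lemma path_edges_rev: "path_edges (rev xs) = path_edges xs"
proof (induction xs rule: path_edges.induct)
  case (1 x y zs)
  then show ?case using path_edges_append[of "rev zs" y "[x]"] by (auto simp: insert_commute)
qed auto

lemma path_edges_subset: "e \<in> path_edges xs \<Longrightarrow> e \<subseteq> set xs"
  by (induction xs rule: path_edges.induct) auto

lemma path_edges_meet_prefix: "e \<in> path_edges (xs @ [y]) \<Longrightarrow> e \<inter> set xs \<noteq> {}"
proof (induction xs)
  case (Cons x xs)
  then show ?case by (cases xs) auto
qed auto

text \<open>
  Hence two paths with the same ends and disjoint inner vertices share no edge, unless both
  consist of the edge between their ends.
\<close>
lemma path_edges_meet_interior:
  assumes "xs \<noteq> []" "e \<in> path_edges (a # xs @ [b])"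
  shows "e \<inter> set xs \<noteq> {}"
  using assms path_edges_meet_prefix[of e xs b] by (cases xs) auto

locale outer_drawing =
  fixes G :: "'a pair_pre_digraph" and p :: "'a \<Rightarrow> complex" and c :: "'a set \<Rightarrow> real \<Rightarrow> complex"
  assumes pg: "pair_graph G" and drawing: "planar_drawing G p c"
    and outer: "p ` pverts G \<subseteq> frontier (outside (drawing_image G p c))"
begin

abbreviation chain :: "'a list \<Rightarrow> bool" where
  "chain \<equiv> successively (\<lambda>x y. (x, y) \<in> parcs G)"

definition trace :: "'a list \<Rightarrow> complex set" where
  "trace xs = (\<Union>e \<in> path_edges xs. path_image (c e))"

lemma arc_verts: "(x, y) \<in> parcs G \<Longrightarrow> x \<in> pverts G" "(x, y) \<in> parcs G \<Longrightarrow> y \<in> pverts G"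
  and arc_neq: "(x, y) \<in> parcs G \<Longrightarrow> x \<noteq> y"
  and arc_sym: "(x, y) \<in> parcs G \<Longrightarrow> (y, x) \<in> parcs G"
proof -
  interpret pair_graph G by (rule pg)
  show "(x, y) \<in> parcs G \<Longrightarrow> x \<in> pverts G" "(x, y) \<in> parcs G \<Longrightarrow> y \<in> pverts G"
    by (auto dest: wellformed')
  show "(x, y) \<in> parcs G \<Longrightarrow> x \<noteq> y" using no_loops' by auto
  show "(x, y) \<in> parcs G \<Longrightarrow> (y, x) \<in> parcs G" using arcs_symmetric by auto
qed

lemma edges_meet:
  assumes "(x, y) \<in> parcs G" "(u, v) \<in> parcs G" "{x, y} \<noteq> {u, v}"
  shows "path_image (c {x, y}) \<inter> path_image (c {u, v}) \<subseteq> p ` ({x, y} \<inter> {u, v})"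
proof -
  have *: "\<forall>(u, v) \<in> parcs G. \<forall>(x, y) \<in> parcs G. {u, v} \<noteq> {x, y} \<longrightarrow>
        path_image (c {u, v}) \<inter> path_image (c {x, y}) \<subseteq> p ` ({u, v} \<inter> {x, y})"
    using drawing by (simp add: planar_drawing_def)
  show ?thesis using bspec[OF bspec[OF *, OF assms(1), simplified], OF assms(2)] assms(3) by simp
qed

lemma chain_edge: "chain xs \<Longrightarrow> e \<in> path_edges xs \<Longrightarrow> \<exists>x y. e = {x, y} \<and> (x, y) \<in> parcs G"
  by (induction xs rule: path_edges.induct) auto

lemma trace_Int:
  assumes "chain xs" "chain ys" "path_edges xs \<inter> path_edges ys = {}"
  shows "trace xs \<inter> trace ys \<subseteq> p ` (set xs \<inter> set ys)"
proof
  fix z assume "z \<in> trace xs \<inter> trace ys"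
  then obtain e f where e: "e \<in> path_edges xs" "z \<in> path_image (c e)"
    and f: "f \<in> path_edges ys" "z \<in> path_image (c f)" by (auto simp: trace_def)
  obtain x y where xy: "e = {x, y}" "(x, y) \<in> parcs G" using chain_edge[OF assms(1) e(1)] by auto
  obtain u v where uv: "f = {u, v}" "(u, v) \<in> parcs G" using chain_edge[OF assms(2) f(1)] by auto
  have "e \<noteq> f" using e f assms(3) by auto
  then have "path_image (c e) \<inter> path_image (c f) \<subseteq> p ` (e \<inter> f)"
    using edges_meet xy uv by simp
  then show "z \<in> p ` (set xs \<inter> set ys)"
    using e f path_edges_subset[OF e(1)] path_edges_subset[OF f(1)] by blast
qed

lemma edge_arc:
  assumes "(x, y) \<in> parcs G"
  obtains g where "arc g" "pathstart g = p x" "pathfinish g = p y" "path_image g = path_image (c {x, y})"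
proof -
  have *: "arc (c {x, y})" "{pathstart (c {x, y}), pathfinish (c {x, y})} = {p x, p y}"
    using drawing assms unfolding planar_drawing_def by auto
  then consider "pathstart (c {x, y}) = p x \<and> pathfinish (c {x, y}) = p y"
    | "pathstart (c {x, y}) = p y \<and> pathfinish (c {x, y}) = p x" by (auto simp: doubleton_eq_iff)
  then show thesis
  proof cases
    case 1 then show thesis using * that by auto
  next
    case 2 then show thesis using * that[of "reversepath (c {x, y})"] by (auto simp: arc_reversepath)
  qed
qed

lemma trace_arc:
  assumes "distinct xs" "chain xs" "2 \<le> length xs"
  shows "\<exists>g. arc g \<and> pathstart g = p (hd xs) \<and> pathfinish g = p (last xs) \<and> path_image g = trace xs"
  using assms
proof (induction xs rule: path_edges.induct)
  case (1 x y zs)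
  then have xy: "(x, y) \<in> parcs G" by auto
  obtain g where g: "arc g" "pathstart g = p x" "pathfinish g = p y" "path_image g = path_image (c {x, y})"
    using edge_arc[OF xy] by blast
  show ?case
  proof (cases zs)
    case Nil
    then show ?thesis using g by (auto simp: trace_def)
  next
    case (Cons z ws)
    obtain h where h: "arc h" "pathstart h = p y" "pathfinish h = p (last (y # zs))"
      "path_image h = trace (y # zs)"
      using 1 Cons by auto
    have "{x, y} \<notin> path_edges (y # zs)" using path_edges_subset[of "{x, y}" "y # zs"] 1 by auto
    then have "trace [x, y] \<inter> trace (y # zs) \<subseteq> p ` (set [x, y] \<inter> set (y # zs))"
      using 1 xy by (intro trace_Int) auto
    also have "\<dots> = {p y}" using 1 by auto
    finally have "path_image g \<inter> path_image h \<subseteq> {p y}"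
      using g h by (simp add: trace_def)
    then have "arc (g +++ h)" using g h by (intro arc_join) auto
    moreover have "path_image (g +++ h) = trace (x # y # zs)"
      using g h by (simp add: path_image_join trace_def)
    ultimately show ?thesis using g h by (intro exI[of _ "g +++ h"]) auto
  qed
qed auto

lemma trace_verts:
  assumes "chain xs" "2 \<le> length xs" shows "p ` set xs \<subseteq> trace xs"
  using assms
proof (induction xs rule: path_edges.induct)
  case (1 x y zs)
  then have "{p x, p y} \<subseteq> path_image (c {x, y})"
    using drawing unfolding planar_drawing_def by auto
  then show ?case using 1 by (cases zs) (auto simp: trace_def)
qed auto

lemma trace_subset_drawing: "chain xs \<Longrightarrow> trace xs \<subseteq> drawing_image G p c"
  unfolding trace_def drawing_image_def using chain_edge by fastforce

text \<open>
  The inside of a closed part of the drawing is open and disjoint from the outer face, whose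
  closure contains every vertex.
\<close>
lemma vertex_notin_inside:
  assumes "S \<subseteq> drawing_image G p c" "closed S" "v \<in> pverts G"
  shows "p v \<notin> inside S"
proof
  assume v: "p v \<in> inside S"
  have "p v \<in> closure (outside (drawing_image G p c))"
    using outer assms(3) by (auto simp: frontier_def)
  moreover have "open (inside S)" using assms(2) by (rule open_inside)
  ultimately have "inside S \<inter> outside (drawing_image G p c) \<noteq> {}"
    using v open_Int_closure_eq_empty[of "inside S" "outside (drawing_image G p c)"] by blast
  then show False using outside_mono[OF assms(1)] inside_Int_outside[of S] by blast
qed

text \<open>
  At most one of the three paths may be a single edge, here the third; two such paths would be
  the same arc.
\<close>
lemma theta_arcs:
  assumes ab: "a \<noteq> b"
    and P: "chain (a # P @ [b])" "distinct (a # P @ [b])"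
    and Q: "chain (a # Q @ [b])" "distinct (a # Q @ [b])"
    and R: "chain (a # R @ [b])" "distinct (a # R @ [b])"
    and PQ: "set P \<inter> set Q = {}" and PR: "set P \<inter> set R = {}" and QR: "set Q \<inter> set R = {}"
    and ne: "P \<noteq> []" "Q \<noteq> []"
  obtains g1 g2 g3 where "arc g1" "arc g2" "arc g3"
    "path_image g1 = trace (a # P @ [b])" "path_image g2 = trace (a # Q @ [b])" "path_image g3 = trace (a # R @ [b])"
    "pathstart g1 = p a" "pathfinish g1 = p b" "pathstart g2 = p a" "pathfinish g2 = p b"
    "pathstart g3 = p a" "pathfinish g3 = p b"
    "path_image g1 \<inter> path_image g2 = {p a, p b}" "path_image g1 \<inter> path_image g3 = {p a, p b}"
    "path_image g2 \<inter> path_image g3 = {p a, p b}"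
proof -
  have meet: "trace (a # X @ [b]) \<inter> trace (a # Y @ [b]) = {p a, p b}"
    if X: "chain (a # X @ [b])" "X \<noteq> []" and Y: "chain (a # Y @ [b])" and XY: "set X \<inter> set Y = {}"
      and d: "distinct (a # X @ [b])" for X Y
  proof
    have "path_edges (a # X @ [b]) \<inter> path_edges (a # Y @ [b]) = {}"
    proof (rule ccontr)
      assume "\<not> ?thesis"
      then obtain e where e: "e \<in> path_edges (a # X @ [b])" "e \<in> path_edges (a # Y @ [b])" by auto
      show False
        using path_edges_meet_interior[OF X(2) e(1)] path_edges_subset[OF e(2)] XY d by auto
    qed
    then have "trace (a # X @ [b]) \<inter> trace (a # Y @ [b]) \<subseteq> p ` (set (a # X @ [b]) \<inter> set (a # Y @ [b]))"
      using X Y by (intro trace_Int) auto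
    then show "trace (a # X @ [b]) \<inter> trace (a # Y @ [b]) \<subseteq> {p a, p b}"
      using XY by auto
    show "{p a, p b} \<subseteq> trace (a # X @ [b]) \<inter> trace (a # Y @ [b])"
      using trace_verts[OF X(1)] trace_verts[OF Y] by auto
  qed
  have arc: "\<exists>g. arc g \<and> pathstart g = p a \<and> pathfinish g = p b \<and> path_image g = trace (a # X @ [b])"
    if "chain (a # X @ [b])" "distinct (a # X @ [b])" for X
    using trace_arc[OF that(2,1)] by simp
  show thesis
    using arc[OF P] arc[OF Q] arc[OF R] meet[OF P(1) ne(1) Q(1) PQ P(2)]
      meet[OF P(1) ne(1) R(1) PR P(2)] meet[OF Q(1) ne(2) R(1) QR Q(2)] that by metis
qed

lemma interior_vertex:
  assumes X: "chain (a # X @ [b])" "distinct (a # X @ [b])" "x \<in> set X"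
  shows "p x \<in> trace (a # X @ [b]) - {p a, p b}" "x \<in> pverts G"
proof -
  obtain Y Z where "X = Y @ x # Z" using X(3) by (auto simp: in_set_conv_decomp)
  then show x: "x \<in> pverts G"
    using X(1) arc_verts by (cases Y rule: rev_cases) (auto simp: successively_append_iff successively_Cons)
  have "a \<in> pverts G" "b \<in> pverts G"
    using X arc_verts by (cases X rule: rev_cases; cases X; auto simp: successively_append_iff successively_Cons)+
  moreover have "inj_on p (pverts G)" using drawing by (simp add: planar_drawing_def)
  ultimately have "p x \<noteq> p a" "p x \<noteq> p b" using x X by (auto dest!: inj_onD)
  then show "p x \<in> trace (a # X @ [b]) - {p a, p b}"
    using trace_verts[OF X(1)] X(3) by auto
qed

text \<open>
  A path with an inner vertex cannot run inside a closed curve of the drawing.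
\<close>
lemma trace_not_inside:
  assumes X: "chain (a # X @ [b])" "distinct (a # X @ [b])" "X \<noteq> []"
    and gh: "arc g" "arc h" "path_image g \<subseteq> drawing_image G p c" "path_image h \<subseteq> drawing_image G p c"
  shows "\<not> trace (a # X @ [b]) - {p a, p b} \<subseteq> inside (path_image g \<union> path_image h)"
proof
  assume S: "trace (a # X @ [b]) - {p a, p b} \<subseteq> inside (path_image g \<union> path_image h)"
  have x: "hd X \<in> set X" using X(3) by simp
  have "closed (path_image g \<union> path_image h)" using gh by (simp add: closed_arc_image closed_Un)
  then show False
    using vertex_notin_inside[of "path_image g \<union> path_image h" "hd X"] interior_vertex[OF X(1,2) x] S gh by blast
qed

lemma theta_free:
  assumes P: "chain (a # P @ [b])" and Q: "chain (a # Q @ [b])" and R: "chain (a # R @ [b])"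
    and dist: "distinct (a # b # P @ Q @ R)" and ne: "P \<noteq> []" "Q \<noteq> []" "R \<noteq> []"
  shows False
proof -
  have d: "a \<noteq> b" "distinct (a # P @ [b])" "distinct (a # Q @ [b])" "distinct (a # R @ [b])"
    "set P \<inter> set Q = {}" "set P \<inter> set R = {}" "set Q \<inter> set R = {}" using dist by auto
  obtain g1 g2 g3 where arcs: "arc g1" "arc g2" "arc g3"
    and im: "path_image g1 = trace (a # P @ [b])" "path_image g2 = trace (a # Q @ [b])" "path_image g3 = trace (a # R @ [b])"
    and rest: "pathstart g1 = p a" "pathfinish g1 = p b" "pathstart g2 = p a" "pathfinish g2 = p b"
    "pathstart g3 = p a" "pathfinish g3 = p b"
    "path_image g1 \<inter> path_image g2 = {p a, p b}" "path_image g1 \<inter> path_image g3 = {p a, p b}"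
    "path_image g2 \<inter> path_image g3 = {p a, p b}"
    using theta_arcs[OF d(1) P d(2) Q d(3) R d(4-7) ne(1,2)] by blast
  have D: "path_image g1 \<subseteq> drawing_image G p c" "path_image g2 \<subseteq> drawing_image G p c" "path_image g3 \<subseteq> drawing_image G p c"
    using trace_subset_drawing P Q R by (auto simp: im)
  from theta_curve[OF arcs rest] show False
    using trace_not_inside[OF P d(2) ne(1), of g2 g3] trace_not_inside[OF Q d(3) ne(2), of g1 g3]
      trace_not_inside[OF R d(4) ne(3), of g1 g2] arcs D
    unfolding im by blast
qed

text \<open>
  Of the three arcs given by a cycle and a chord, only the chord has no inner vertex.
\<close>
lemma chord_inside:
  assumes P: "chain (a # P @ [b])" and Q: "chain (a # Q @ [b])" and R: "(a, b) \<in> parcs G"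
    and dist: "distinct (a # b # P @ Q)" and ne: "P \<noteq> []" "Q \<noteq> []"
  obtains g1 g2 e where "arc g1" "arc g2" "arc e"
    "path_image g1 = trace (a # P @ [b])" "path_image g2 = trace (a # Q @ [b])" "path_image e = path_image (c {a, b})"
    "pathstart g1 = p a" "pathfinish g1 = p b" "pathstart g2 = p a" "pathfinish g2 = p b"
    "pathstart e = p a" "pathfinish e = p b"
    "path_image g1 \<inter> path_image g2 = {p a, p b}" "path_image g1 \<inter> path_image e = {p a, p b}"
    "path_image g2 \<inter> path_image e = {p a, p b}"
    "path_image e - {p a, p b} \<subseteq> inside (path_image g1 \<union> path_image g2)"
proof -
  have d: "a \<noteq> b" "distinct (a # P @ [b])" "distinct (a # Q @ [b])" "distinct (a # [] @ [b])"
    "set P \<inter> set Q = {}" "set P \<inter> set [] = {}" "set Q \<inter> set [] = {}" using dist by auto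
  have R': "chain (a # [] @ [b])" using R by simp
  obtain g1 g2 g3 where arcs: "arc g1" "arc g2" "arc g3"
    and im: "path_image g1 = trace (a # P @ [b])" "path_image g2 = trace (a # Q @ [b])" "path_image g3 = trace (a # [] @ [b])"
    and rest: "pathstart g1 = p a" "pathfinish g1 = p b" "pathstart g2 = p a" "pathfinish g2 = p b"
    "pathstart g3 = p a" "pathfinish g3 = p b"
    "path_image g1 \<inter> path_image g2 = {p a, p b}" "path_image g1 \<inter> path_image g3 = {p a, p b}"
    "path_image g2 \<inter> path_image g3 = {p a, p b}"
    using theta_arcs[OF d(1) P d(2) Q d(3) R' d(4-7) ne(1,2)] by blast
  have D: "path_image g1 \<subseteq> drawing_image G p c" "path_image g2 \<subseteq> drawing_image G p c" "path_image g3 \<subseteq> drawing_image G p c"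
    using trace_subset_drawing P Q R' by (auto simp: im)
  have "path_image g3 - {p a, p b} \<subseteq> inside (path_image g1 \<union> path_image g2)"
    using theta_curve[OF arcs rest] trace_not_inside[OF P d(2) ne(1), of g2 g3]
      trace_not_inside[OF Q d(3) ne(2), of g1 g3] arcs D
    unfolding im by blast
  moreover have "path_image g3 = path_image (c {a, b})" by (simp add: im trace_def)
  ultimately show thesis using that arcs im rest by metis
qed

text \<open>
  Both chords run inside the cycle, so they would have to meet by
  \<open>chords_inside_closed_curve_meet\<close>, although they have no common end.
\<close>
lemma crossing_free:
  assumes cyc: "chain (a # P @ b # Q @ x # R @ d # S @ [a])"
    and dist: "distinct (a # P @ b # Q @ x # R @ d # S)"
    and ax: "(a, x) \<in> parcs G" and bd: "(b, d) \<in> parcs G"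
  shows False
proof -
  have sym: "chain (rev xs)" if "chain xs" for xs
    using that arc_sym by (simp add: successively_rev) (metis (mono_tags, lifting) successively_mono)
  have sub: "chain ys" if "chain (xs @ ys @ zs)" for xs ys zs
    using that by (simp add: successively_append_iff)
  have glue: "chain (xs @ y # ys)" if "chain (xs @ [y])" "chain (y # ys)" for xs y ys
    using that by (auto simp: successively_append_iff)
  have ch: "chain (a # (P @ b # Q) @ [x])" "chain (a # rev (R @ d # S) @ [x])"
    "chain (b # (Q @ x # R) @ [d])" "chain (b # rev (S @ a # P) @ [d])"
  proof -
    show "chain (a # (P @ b # Q) @ [x])"
      using sub[of "[]" "a # (P @ b # Q) @ [x]" "R @ d # S @ [a]"] cyc by simp
    show "chain (b # (Q @ x # R) @ [d])"
      using sub[of "a # P" "b # (Q @ x # R) @ [d]" "S @ [a]"] cyc by simp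
    have "chain (x # (R @ d # S) @ [a])"
      using sub[of "a # P @ b # Q" "x # (R @ d # S) @ [a]" "[]"] cyc by simp
    then show "chain (a # rev (R @ d # S) @ [x])" by (auto dest: sym)
    have "chain ((d # S) @ [a])" "chain (a # P @ [b])"
      using sub[of "a # P @ b # Q @ x # R" "d # S @ [a]" "[]"] sub[of "[]" "a # P @ [b]" "Q @ x # R @ d # S @ [a]"] cyc by simp_all
    from glue[OF this] have "chain (d # (S @ a # P) @ [b])" by simp
    then show "chain (b # rev (S @ a # P) @ [d])" by (auto dest: sym)
  qed
  have dd: "distinct (a # x # (P @ b # Q) @ rev (R @ d # S))" "distinct (b # d # (Q @ x # R) @ rev (S @ a # P))"
    using dist by auto
  have nn: "P @ b # Q \<noteq> []" "rev (R @ d # S) \<noteq> []" "Q @ x # R \<noteq> []" "rev (S @ a # P) \<noteq> []" by auto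
  obtain g1 g2 e where A: "arc g1" "arc g2" "arc e"
    "path_image g1 = trace (a # (P @ b # Q) @ [x])" "path_image g2 = trace (a # rev (R @ d # S) @ [x])" "path_image e = path_image (c {a, x})"
    "pathstart g1 = p a" "pathfinish g1 = p x" "pathstart g2 = p a" "pathfinish g2 = p x"
    "pathstart e = p a" "pathfinish e = p x"
    "path_image g1 \<inter> path_image g2 = {p a, p x}" "path_image g1 \<inter> path_image e = {p a, p x}"
    "path_image g2 \<inter> path_image e = {p a, p x}"
    "path_image e - {p a, p x} \<subseteq> inside (path_image g1 \<union> path_image g2)"
    using chord_inside[OF ch(1,2) ax dd(1) nn(1,2)] by blast
  obtain h1 h2 f where B: "arc h1" "arc h2" "arc f"
    "path_image h1 = trace (b # (Q @ x # R) @ [d])" "path_image h2 = trace (b # rev (S @ a # P) @ [d])" "path_image f = path_image (c {b, d})"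
    "pathstart h1 = p b" "pathfinish h1 = p d" "pathstart h2 = p b" "pathfinish h2 = p d"
    "pathstart f = p b" "pathfinish f = p d"
    "path_image h1 \<inter> path_image h2 = {p b, p d}" "path_image h1 \<inter> path_image f = {p b, p d}"
    "path_image h2 \<inter> path_image f = {p b, p d}"
    "path_image f - {p b, p d} \<subseteq> inside (path_image h1 \<union> path_image h2)"
    using chord_inside[OF ch(3,4) bd dd(2) nn(3,4)] by blast
  have "path_edges (a # (P @ b # Q) @ [x]) \<union> path_edges (a # rev (R @ d # S) @ [x])
    = path_edges (b # (Q @ x # R) @ [d]) \<union> path_edges (b # rev (S @ a # P) @ [d])"
  proof -
    have r: "path_edges (a # rev (R @ d # S) @ [x]) = path_edges (x # (R @ d # S) @ [a])"
      "path_edges (b # rev (S @ a # P) @ [d]) = path_edges (d # (S @ a # P) @ [b])"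
      using path_edges_rev[of "x # (R @ d # S) @ [a]"] path_edges_rev[of "d # (S @ a # P) @ [b]"] by auto
    show ?thesis unfolding r
      using path_edges_append[of "a # P" b "Q @ [x]"] path_edges_append[of "x # R" d "S @ [a]"]
        path_edges_append[of "b # Q" x "R @ [d]"] path_edges_append[of "d # S" a "P @ [b]"] by auto
  qed
  then have un: "path_image h1 \<union> path_image h2 = path_image g1 \<union> path_image g2"
    unfolding A B trace_def by (metis UN_Un)
  have "path_edges [a, x] \<inter> path_edges [b, d] = {}" using dist by (auto simp: doubleton_eq_iff)
  then have "trace [a, x] \<inter> trace [b, d] \<subseteq> p ` (set [a, x] \<inter> set [b, d])"
    using ax bd by (intro trace_Int) simp_all
  moreover have "set [a, x] \<inter> set [b, d] = {}" using dist by auto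
  ultimately have ef: "path_image e \<inter> path_image f = {}" by (simp add: trace_def A B)
  have b: "p b \<in> path_image g1 - {p a, p x}"
    using interior_vertex[OF ch(1), of b] dist by (auto simp: A)
  have d: "p d \<in> path_image g2 - {p a, p x}"
    using interior_vertex[OF ch(2), of d] dist by (auto simp: A)
  have "path_image e \<inter> path_image f \<noteq> {}"
    by (rule chords_inside_closed_curve_meet[OF A(1-3) B(3) A(7-12) B(11-12) A(13-16) B(16)[unfolded un] b d])
  then show False using ef by contradiction
qed

end

section \<open>Counting induced three-vertex paths\<close>

locale adjacency =
  fixes E :: "'a rel"
  assumes sym_E: "(x, y) \<in> E \<Longrightarrow> (y, x) \<in> E" and irrefl_E: "(x, x) \<notin> E"
begin

abbreviation chain :: "'a list \<Rightarrow> bool" where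
  "chain \<equiv> successively (\<lambda>x y. (x, y) \<in> E)"

definition nbrs :: "'a set \<Rightarrow> 'a \<Rightarrow> 'a set" where
  "nbrs U v = {w \<in> U. (v, w) \<in> E}"

text \<open>
  The sets that induce a path on three vertices; \<open>b\<close> is the centre.
\<close>
definition P3s :: "'a set \<Rightarrow> 'a set set" where
  "P3s U = {S. S \<subseteq> U \<and> (\<exists>a b c. S = {a, b, c} \<and> a \<noteq> c \<and> (a, b) \<in> E \<and> (b, c) \<in> E \<and> (a, c) \<notin> E)}"

definition P3s_at :: "'a set \<Rightarrow> 'a \<Rightarrow> 'a set set" where
  "P3s_at U v = {S \<in> P3s U. v \<in> S}"

lemma finite_nbrs [simp]: "finite U \<Longrightarrow> finite (nbrs U v)"
  by (simp add: nbrs_def)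

lemma finite_P3s [simp]: "finite U \<Longrightarrow> finite (P3s U)"
  by (rule finite_subset[of _ "Pow U"]) (auto simp: P3s_def)

lemma card_P3s_insert:
  assumes "finite W" "v \<notin> W"
  shows "card (P3s (insert v W)) = card (P3s W) + card (P3s_at (insert v W) v)"
proof -
  have "P3s (insert v W) = P3s W \<union> P3s_at (insert v W) v"
    unfolding P3s_def P3s_at_def by blast
  moreover have "P3s W \<inter> P3s_at (insert v W) v = {}"
    using assms(2) unfolding P3s_def P3s_at_def by blast
  ultimately show ?thesis
    using assms(1) finite_P3s[of "insert v W"] by (simp add: card_Un_disjoint)
qed

text \<open>
  A copy through v either has its centre at v, and then its ends are nonadjacent neighbours of
  v, or it has v as an end, and then its centre is a neighbour x of v and its other end is a
  neighbour of x that is not adjacent to v.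
\<close>
lemma P3s_at_insert:
  assumes "v \<notin> W"
  shows "P3s_at (insert v W) v =
    {{v, x, y} | x y. x \<in> nbrs W v \<and> y \<in> nbrs W v \<and> x \<noteq> y \<and> (x, y) \<notin> E} \<union>
    {{v, x, y} | x y. x \<in> nbrs W v \<and> y \<in> nbrs W x \<and> y \<notin> nbrs W v}" (is "?L = ?C \<union> ?D")
proof
  show "?L \<subseteq> ?C \<union> ?D"
  proof
    fix S assume "S \<in> ?L"
    then obtain a b c where S: "S = {a, b, c}" "S \<subseteq> insert v W" "v \<in> S" "a \<noteq> c" "(a, b) \<in> E" "(b, c) \<in> E" "(a, c) \<notin> E"
      unfolding P3s_at_def P3s_def by blast
    have ne: "a \<noteq> b" "b \<noteq> c" using S irrefl_E by auto
    consider "v = a" | "v = b" | "v = c" using S by auto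
    then show "S \<in> ?C \<union> ?D"
    proof cases
      case 1
      then have "S = {v, b, c}" "b \<in> nbrs W v" "c \<in> nbrs W b" "c \<notin> nbrs W v"
        using S ne unfolding nbrs_def by auto
      then show ?thesis by blast
    next
      case 2
      then have "S = {v, a, c}" "a \<in> nbrs W v" "c \<in> nbrs W v"
        using S ne sym_E unfolding nbrs_def by auto
      then show ?thesis using S by blast
    next
      case 3
      then have "S = {v, b, a}" "b \<in> nbrs W v" "a \<in> nbrs W b" "a \<notin> nbrs W v"
        using S ne sym_E unfolding nbrs_def by auto
      then show ?thesis by blast
    qed
  qed
  show "?C \<union> ?D \<subseteq> ?L"
  proof
    fix S assume "S \<in> ?C \<union> ?D"
    then consider x y where "S = {v, x, y}" "x \<in> nbrs W v" "y \<in> nbrs W v" "x \<noteq> y" "(x, y) \<notin> E"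
      | x y where "S = {v, x, y}" "x \<in> nbrs W v" "y \<in> nbrs W x" "y \<notin> nbrs W v" by blast
    then show "S \<in> ?L"
    proof cases
      case 1
      then have "S = {x, v, y}" "(x, v) \<in> E" "(v, y) \<in> E" "S \<subseteq> insert v W"
        unfolding nbrs_def using sym_E by auto
      then show ?thesis using 1 unfolding P3s_at_def P3s_def by blast
    next
      case 2
      then have "v \<noteq> y" "(v, x) \<in> E" "(x, y) \<in> E" "(v, y) \<notin> E" "S \<subseteq> insert v W"
        unfolding nbrs_def using assms by auto
      then show ?thesis using 2 unfolding P3s_at_def P3s_def by blast
    qed
  qed
qed

lemma card_triples:
  assumes "v \<notin> X" "u \<notin> X"
  shows "card ((\<lambda>x. {v, u, x}) ` X) = card X"
  using assms by (intro card_image) (auto simp: inj_on_def doubleton_eq_iff)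

lemma card_P3s_at_0:
  assumes "v \<notin> W" "nbrs W v = {}" shows "card (P3s_at (insert v W) v) = 0"
  unfolding P3s_at_insert[OF assms(1)] using assms by simp

lemma card_P3s_at_1:
  assumes "v \<notin> W" "nbrs W v = {u}"
  shows "card (P3s_at (insert v W) v) = card (nbrs W u)"
proof -
  have "u \<notin> nbrs W u" using irrefl_E by (auto simp: nbrs_def)
  moreover have "v \<notin> nbrs W u" using assms by (auto simp: nbrs_def)
  moreover have "P3s_at (insert v W) v = (\<lambda>x. {v, u, x}) ` nbrs W u"
    unfolding P3s_at_insert[OF assms(1)] assms(2) using irrefl_E by (auto simp: nbrs_def)
  ultimately show ?thesis by (simp add: card_triples)
qed

lemma card_P3s_at_2_adjacent:
  assumes "v \<notin> W" "finite W" "nbrs W v = {u, w}" "(u, w) \<in> E"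
  shows "card (P3s_at (insert v W) v) = card (nbrs W u - {w}) + card (nbrs W w - {u})"
proof -
  have ir: "u \<notin> nbrs W u" "w \<notin> nbrs W w" "u \<noteq> w" using assms(4) irrefl_E by (auto simp: nbrs_def)
  have nv: "v \<notin> nbrs W u" "v \<notin> nbrs W w" using assms by (auto simp: nbrs_def)
  have uw: "u \<in> W" "w \<in> W" using assms(3) by (auto simp: nbrs_def)
  have "P3s_at (insert v W) v =
    (\<lambda>x. {v, u, x}) ` (nbrs W u - {w}) \<union> (\<lambda>x. {v, w, x}) ` (nbrs W w - {u})"
    unfolding P3s_at_insert[OF assms(1)] assms(3) using ir assms(4) sym_E by auto
  moreover have "(\<lambda>x. {v, u, x}) ` (nbrs W u - {w}) \<inter> (\<lambda>x. {v, w, x}) ` (nbrs W w - {u}) = {}"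
    using ir nv uw assms(1) by (auto simp: doubleton_eq_iff insert_eq_iff)
  ultimately show ?thesis using ir nv assms(2) by (simp add: card_Un_disjoint card_triples)
qed

lemma card_P3s_at_2_nonadjacent:
  assumes "v \<notin> W" "finite W" "nbrs W v = {u, w}" "(u, w) \<notin> E" "u \<noteq> w"
  shows "card (P3s_at (insert v W) v) = 1 + card (nbrs W u) + card (nbrs W w)"
proof -
  have ir: "u \<notin> nbrs W u" "w \<notin> nbrs W w" "w \<notin> nbrs W u" "u \<notin> nbrs W w" using assms(4) irrefl_E sym_E by (auto simp: nbrs_def)
  have nv: "v \<notin> nbrs W u" "v \<notin> nbrs W w" using assms by (auto simp: nbrs_def)
  have uw: "u \<in> W" "w \<in> W" using assms(3) by (auto simp: nbrs_def)
  have "P3s_at (insert v W) v = insert {v, u, w}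
    ((\<lambda>x. {v, u, x}) ` nbrs W u \<union> (\<lambda>x. {v, w, x}) ` nbrs W w)"
    unfolding P3s_at_insert[OF assms(1)] assms(3) using ir assms(4,5) sym_E by (auto simp: insert_commute)
  moreover have "(\<lambda>x. {v, u, x}) ` nbrs W u \<inter> (\<lambda>x. {v, w, x}) ` nbrs W w = {}"
    using ir nv uw assms(1,5) by (auto simp: doubleton_eq_iff insert_eq_iff)
  moreover have "{v, u, w} \<notin> (\<lambda>x. {v, u, x}) ` nbrs W u \<union> (\<lambda>x. {v, w, x}) ` nbrs W w"
    using ir nv uw assms(1,5) by (auto simp: doubleton_eq_iff insert_eq_iff)
  ultimately show ?thesis using ir nv assms(2) by (simp add: card_Un_disjoint card_triples)
qed

text \<open>
  With \<open>F\<close> the image of a fixed edge set under positions in the list, this says that the subgraph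
  on \<open>U\<close> is isomorphic to a fixed graph.
\<close>
definition induced :: "'a set \<Rightarrow> 'a list \<Rightarrow> 'a rel \<Rightarrow> bool" where
  "induced U xs F \<longleftrightarrow> distinct xs \<and> U = set xs \<and> E \<inter> U \<times> U = F \<union> F\<inverse>"

definition star :: "'a set \<Rightarrow> 'a \<Rightarrow> bool" where
  "star U z \<longleftrightarrow> z \<in> U \<and> E \<inter> U \<times> U = {z} \<times> (U - {z}) \<union> (U - {z}) \<times> {z}"

lemma nbrs_induced: "induced U xs F \<Longrightarrow> x \<in> U \<Longrightarrow> nbrs U x = (F \<union> F\<inverse>) `` {x}"
  unfolding induced_def nbrs_def by blast

lemma adj_induced: "induced U xs F \<Longrightarrow> x \<in> U \<Longrightarrow> y \<in> U \<Longrightarrow> (x, y) \<in> E \<longleftrightarrow> (x, y) \<in> F \<union> F\<inverse>"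
  unfolding induced_def by blast

lemma nbrs_insert_self: "nbrs (insert v W) v = nbrs W v"
  using irrefl_E by (auto simp: nbrs_def)

lemma edges_insert:
  assumes "v \<notin> W"
  shows "E \<inter> insert v W \<times> insert v W = E \<inter> W \<times> W \<union> {v} \<times> nbrs W v \<union> nbrs W v \<times> {v}"
  using irrefl_E sym_E by (auto simp: nbrs_def)

lemma induced_insert:
  assumes "induced W xs F" "v \<notin> W" "nbrs W v = M"
    and "distinct ys" "set ys = insert v (set xs)" "F' \<union> F'\<inverse> = (F \<union> F\<inverse>) \<union> {v} \<times> M \<union> M \<times> {v}"
  shows "induced (insert v W) ys F'"
proof -
  have W: "distinct xs" "W = set xs" "E \<inter> W \<times> W = F \<union> F\<inverse>" using assms(1) by (auto simp: induced_def)
  have "E \<inter> insert v W \<times> insert v W = F' \<union> F'\<inverse>"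
    unfolding edges_insert[OF assms(2)] W(3) assms(3,6) ..
  then show ?thesis using assms(4,5) W(2) by (simp add: induced_def)
qed

lemma star_insert:
  assumes "star W z" "v \<notin> W" "nbrs W v = {z}"
  shows "star (insert v W) z"
  using assms edges_insert[OF assms(2)] unfolding star_def by auto

lemma nbrs_star:
  assumes "star W z" "x \<in> W" shows "nbrs W x = (if x = z then W - {z} else {z})"
proof -
  have "nbrs W x = (E \<inter> W \<times> W) `` {x}" using assms(2) by (auto simp: nbrs_def)
  also have "\<dots> = (if x = z then W - {z} else {z})" using assms unfolding star_def by auto
  finally show ?thesis .
qed

lemma small_set_cases:
  assumes "card A \<le> 2" "finite A"
  obtains "A = {}" | u where "A = {u}" | u w where "A = {u, w}" "u \<noteq> w"
proof -
  consider "card A = 0" | "card A = 1" | "card A = 2" using assms(1) by linarith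
  then show thesis
    using assms(2) that by cases (auto simp: card_1_singleton_iff card_2_iff)
qed

lemma mem_P3s:
  assumes "a \<noteq> b" "a \<noteq> c" "b \<noteq> c" "{a, b, c} \<subseteq> U"
  shows "{a, b, c} \<in> P3s U \<longleftrightarrow> (a, b) \<in> E \<and> (b, c) \<in> E \<and> (a, c) \<notin> E \<or>
    (a, b) \<in> E \<and> (b, c) \<notin> E \<and> (a, c) \<in> E \<or> (a, b) \<notin> E \<and> (b, c) \<in> E \<and> (a, c) \<in> E" (is "_ \<longleftrightarrow> ?R")
proof
  assume "{a, b, c} \<in> P3s U"
  then obtain x y z where xyz: "{a, b, c} = {x, y, z}" "x \<noteq> z" "(x, y) \<in> E" "(y, z) \<in> E" "(x, z) \<notin> E"
    unfolding P3s_def by blast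
  have "x \<noteq> y" "y \<noteq> z" using xyz irrefl_E by auto
  have "x \<in> {a, b, c}" "y \<in> {a, b, c}" "z \<in> {a, b, c}" unfolding xyz(1) by auto
  then show ?R using xyz(2-5) \<open>x \<noteq> y\<close> \<open>y \<noteq> z\<close> sym_E by auto
next
  have I: "{x, y, z} \<in> P3s U" if "{x, y, z} \<subseteq> U" "x \<noteq> z" "(x, y) \<in> E" "(y, z) \<in> E" "(x, z) \<notin> E" for x y z
    using that unfolding P3s_def by blast
  assume ?R
  then show "{a, b, c} \<in> P3s U"
    using I[of a b c] I[of b a c] I[of a c b] assms sym_E by (auto simp: insert_commute)
qed

lemma card_P3s_4:
  assumes dist: "distinct [a, b, c, d]"
  shows "card (P3s {a, b, c, d}) = (\<Sum>S \<in> {{a, b, c}, {a, b, d}, {a, c, d}, {b, c, d}}. of_bool (S \<in> P3s {a, b, c, d}))"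
proof -
  have "P3s {a, b, c, d} \<subseteq> {{a, b, c}, {a, b, d}, {a, c, d}, {b, c, d}}"
  proof
    fix S assume "S \<in> P3s {a, b, c, d}"
    then obtain x y z where S: "S \<subseteq> {a, b, c, d}" "S = {x, y, z}" "x \<noteq> z" "(x, y) \<in> E" "(y, z) \<in> E"
      unfolding P3s_def by auto
    have "x \<noteq> y" "y \<noteq> z" using S irrefl_E by auto
    then have c3: "card S = 3" using S by simp
    have "S \<noteq> {a, b, c, d}" using c3 dist by auto
    then obtain m where m: "m \<in> {a, b, c, d}" "m \<notin> S" using S(1) by blast
    have "card {a, b, c, d} = 4" using distinct_card[OF dist] by simp
    then have c4: "card ({a, b, c, d} - {m}) = 3" using m(1) by (simp only: card_Diff_singleton)
    have "S \<subseteq> {a, b, c, d} - {m}" using S(1) m(2) by blast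
    then have "S = {a, b, c, d} - {m}" using c3 c4 by (intro card_subset_eq) simp_all
    then show "S \<in> {{a, b, c}, {a, b, d}, {a, c, d}, {b, c, d}}"
      using m(1) dist by auto
  qed
  then have "P3s {a, b, c, d} = {{a, b, c}, {a, b, d}, {a, c, d}, {b, c, d}} \<inter> {S. S \<in> P3s {a, b, c, d}}" by (simp only: Collect_mem_eq Int_absorb1)
  then have "card (P3s {a, b, c, d}) = card ({{a, b, c}, {a, b, d}, {a, c, d}, {b, c, d}} \<inter> {S. S \<in> P3s {a, b, c, d}})" by simp
  also have "\<dots> = (\<Sum>S \<in> {{a, b, c}, {a, b, d}, {a, c, d}, {b, c, d}}. of_bool (S \<in> P3s {a, b, c, d}))"
    by (simp add: sum_of_bool_eq)
  finally show ?thesis .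
qed

text \<open>
  Every triple with two edges is a copy. If all four are copies, the two missing edges form a perfect
  matching. The edge numbers of the triples add up to twice the number of edges, so beside three
  copies the fourth triple has an even number of edges other than two: it is independent, and the
  fourth vertex is adjacent to all of it.
\<close>
lemma four_vertices:
  assumes "card U = 4"
  shows "card (P3s U) \<le> 4"
    and "card (P3s U) = 4 \<Longrightarrow> \<exists>a b c d. induced U [a, b, c, d] {(a, b), (b, c), (c, d), (d, a)}"
    and "card (P3s U) = 3 \<Longrightarrow> \<exists>z. star U z"
proof -
  obtain a b c d where U: "U = {a, b, c, d}" and dist: "distinct [a, b, c, d]"
  proof -
    obtain xs where "set xs = U" "distinct xs" "length xs = 4"
      using assms by (metis card_ge_0_finite distinct_card finite_distinct_list zero_less_numeral)
    then show thesis using that by (auto simp: length_Suc_conv eval_nat_numeral)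
  qed
  have ne: "{a, b, c} \<noteq> {a, b, d}" "{a, b, c} \<noteq> {a, c, d}" "{a, b, c} \<noteq> {b, c, d}"
     "{a, b, d} \<noteq> {a, c, d}" "{a, b, d} \<noteq> {b, c, d}" "{a, c, d} \<noteq> {b, c, d}"
    using dist by (auto simp: set_eq_iff)
  let ?t = "\<lambda>x y z. of_bool ((x, y) \<in> E \<and> (y, z) \<in> E \<and> (x, z) \<notin> E \<or>
    (x, y) \<in> E \<and> (y, z) \<notin> E \<and> (x, z) \<in> E \<or> (x, y) \<notin> E \<and> (y, z) \<in> E \<and> (x, z) \<in> E) :: nat"
  have N: "card (P3s U) = ?t a b c + ?t a b d + ?t a c d + ?t b c d"
    unfolding U card_P3s_4[OF dist] using ne dist by (simp add: mem_P3s)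
  show "card (P3s U) \<le> 4" unfolding N by (simp add: of_bool_def)
  have s: "(b, a) \<in> E \<longleftrightarrow> (a, b) \<in> E" "(c, a) \<in> E \<longleftrightarrow> (a, c) \<in> E" "(d, a) \<in> E \<longleftrightarrow> (a, d) \<in> E"
    "(c, b) \<in> E \<longleftrightarrow> (b, c) \<in> E" "(d, b) \<in> E \<longleftrightarrow> (b, d) \<in> E" "(d, c) \<in> E \<longleftrightarrow> (c, d) \<in> E"
    using sym_E by blast+
  show "\<exists>a b c d. induced U [a, b, c, d] {(a, b), (b, c), (c, d), (d, a)}" if "card (P3s U) = 4"
  proof -
    have "(a, b) \<notin> E \<and> (c, d) \<notin> E \<and> (a, c) \<in> E \<and> (a, d) \<in> E \<and> (b, c) \<in> E \<and> (b, d) \<in> E \<or>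
          (a, c) \<notin> E \<and> (b, d) \<notin> E \<and> (a, b) \<in> E \<and> (a, d) \<in> E \<and> (b, c) \<in> E \<and> (c, d) \<in> E \<or>
          (a, d) \<notin> E \<and> (b, c) \<notin> E \<and> (a, b) \<in> E \<and> (a, c) \<in> E \<and> (b, d) \<in> E \<and> (c, d) \<in> E"
      using that unfolding N of_bool_def by (auto split: if_splits)
    then show ?thesis
    proof (elim disjE)
      assume "(a, b) \<notin> E \<and> (c, d) \<notin> E \<and> (a, c) \<in> E \<and> (a, d) \<in> E \<and> (b, c) \<in> E \<and> (b, d) \<in> E"
      then have "induced U [a, c, b, d] {(a, c), (c, b), (b, d), (d, a)}"
        unfolding induced_def U using dist irrefl_E s by auto
      then show ?thesis by blast
    next
      assume "(a, c) \<notin> E \<and> (b, d) \<notin> E \<and> (a, b) \<in> E \<and> (a, d) \<in> E \<and> (b, c) \<in> E \<and> (c, d) \<in> E"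
      then have "induced U [a, b, c, d] {(a, b), (b, c), (c, d), (d, a)}"
        unfolding induced_def U using dist irrefl_E s by auto
      then show ?thesis by blast
    next
      assume "(a, d) \<notin> E \<and> (b, c) \<notin> E \<and> (a, b) \<in> E \<and> (a, c) \<in> E \<and> (b, d) \<in> E \<and> (c, d) \<in> E"
      then have "induced U [a, b, d, c] {(a, b), (b, d), (d, c), (c, a)}"
        unfolding induced_def U using dist irrefl_E s by auto
      then show ?thesis by blast
    qed
  qed
  show "\<exists>z. star U z" if "card (P3s U) = 3"
  proof -
    have "(a, b) \<in> E \<and> (a, c) \<in> E \<and> (a, d) \<in> E \<and> (b, c) \<notin> E \<and> (b, d) \<notin> E \<and> (c, d) \<notin> E \<or>
          (a, b) \<in> E \<and> (b, c) \<in> E \<and> (b, d) \<in> E \<and> (a, c) \<notin> E \<and> (a, d) \<notin> E \<and> (c, d) \<notin> E \<or>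
          (a, c) \<in> E \<and> (b, c) \<in> E \<and> (c, d) \<in> E \<and> (a, b) \<notin> E \<and> (a, d) \<notin> E \<and> (b, d) \<notin> E \<or>
          (a, d) \<in> E \<and> (b, d) \<in> E \<and> (c, d) \<in> E \<and> (a, b) \<notin> E \<and> (a, c) \<notin> E \<and> (b, c) \<notin> E"
      using that unfolding N of_bool_def by (auto split: if_splits)
    then show ?thesis
    proof (elim disjE)
      assume "(a, b) \<in> E \<and> (a, c) \<in> E \<and> (a, d) \<in> E \<and> (b, c) \<notin> E \<and> (b, d) \<notin> E \<and> (c, d) \<notin> E"
      then have "star U a" unfolding star_def U using dist irrefl_E s by auto
      then show ?thesis ..
    next
      assume "(a, b) \<in> E \<and> (b, c) \<in> E \<and> (b, d) \<in> E \<and> (a, c) \<notin> E \<and> (a, d) \<notin> E \<and> (c, d) \<notin> E"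
      then have "star U b" unfolding star_def U using dist irrefl_E s by auto
      then show ?thesis ..
    next
      assume "(a, c) \<in> E \<and> (b, c) \<in> E \<and> (c, d) \<in> E \<and> (a, b) \<notin> E \<and> (a, d) \<notin> E \<and> (b, d) \<notin> E"
      then have "star U c" unfolding star_def U using dist irrefl_E s by auto
      then show ?thesis ..
    next
      assume "(a, d) \<in> E \<and> (b, d) \<in> E \<and> (c, d) \<in> E \<and> (a, b) \<notin> E \<and> (a, c) \<notin> E \<and> (b, c) \<notin> E"
      then have "star U d" unfolding star_def U using dist irrefl_E s by auto
      then show ?thesis ..
    qed
  qed
qed

text \<open>
  Attached to the centre alone, v extends the star; attached to two leaves it lies in three copies,
  which is enough only for four vertices; every other attachment gives too few copies.
\<close>
lemma star_extend:
  assumes st: "star W z" and W: "finite W" "4 \<le> card W" and v: "v \<notin> W" "card (nbrs W v) \<le> 2"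
    and t: "card W - 1 \<le> card (P3s_at (insert v W) v)"
  shows "star (insert v W) z \<or> card W = 4 \<and> (\<exists>k l. nbrs W v = {k, l} \<and> k \<noteq> l \<and> k \<noteq> z \<and> l \<noteq> z)"
proof -
  have z: "z \<in> W" using st by (simp add: star_def)
  have fn: "finite (nbrs W v)" using W by simp
  have cz: "card (nbrs W x) = 1" if "x \<in> W" "x \<noteq> z" for x using nbrs_star[OF st that(1)] that by simp
  show ?thesis
    using v(2) fn
  proof (cases rule: small_set_cases)
    case 1
    then show ?thesis using t card_P3s_at_0[OF v(1)] W by simp
  next
    case (2 u)
    then have u: "u \<in> W" by (auto simp: nbrs_def)
    show ?thesis
    proof (cases "u = z")
      case True then show ?thesis using star_insert[OF st v(1)] 2 by simp
    next
      case False then show ?thesis using t card_P3s_at_1[OF v(1) 2] cz[OF u False] W by simp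
    qed
  next
    case (3 u w)
    then have uw: "u \<in> W" "w \<in> W" by (auto simp: nbrs_def)
    have centre: False if "k \<noteq> z" "nbrs W v = {z, k}" for k
    proof -
      have k: "k \<in> W" using that by (auto simp: nbrs_def)
      have "(z, k) \<in> E" using nbrs_star[OF st z] k that by (auto simp: nbrs_def)
      then have "card (P3s_at (insert v W) v) = card (W - {z} - {k}) + card ({z} - {z})"
        using card_P3s_at_2_adjacent[OF v(1) W(1) that(2)] nbrs_star[OF st z] nbrs_star[OF st k] that(1) by simp
      also have "\<dots> = card W - 2" using k z that W(1) by (simp add: card_Diff_subset)
      finally show False using t W by simp
    qed
    show ?thesis
    proof (cases "u = z \<or> w = z")
      case True
      then show ?thesis using centre[of u] centre[of w] 3 by (auto simp: insert_commute)
    next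
      case False
      have "(u, w) \<notin> E" using nbrs_star[OF st uw(1)] uw False by (auto simp: nbrs_def)
      then have "card (P3s_at (insert v W) v) = 3"
        using card_P3s_at_2_nonadjacent[OF v(1) W(1) 3(1) _ 3(2)] cz uw False by simp
      then show ?thesis using t W 3 False by auto
    qed
  qed
qed

abbreviation "cycle4 U a b c d \<equiv> induced U [a, b, c, d] {(a, b), (b, c), (c, d), (d, a)}"

abbreviation "pan U a b c d e \<equiv> induced U [a, b, c, d, e] {(a, b), (b, c), (c, d), (d, a), (a, e)}"

abbreviation "house U a b c d e \<equiv> induced U [a, b, c, d, e] {(a, b), (b, c), (c, d), (d, e), (e, a), (a, c)}"

abbreviation "chorded_hexagon U a b c d e f \<equiv>
  induced U [a, b, c, d, e, f] {(a, b), (b, c), (c, d), (d, e), (e, f), (f, a), (a, d)}"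

lemma induced_distinct: "induced U xs F \<Longrightarrow> distinct xs" and induced_set: "induced U xs F \<Longrightarrow> U = set xs"
  by (simp_all add: induced_def)

lemma induced_restrict:
  assumes "induced U xs F" "distinct ys" "set ys \<subseteq> U" "F' \<union> F'\<inverse> = (F \<union> F\<inverse>) \<inter> set ys \<times> set ys"
  shows "induced (set ys) ys F'"
  using assms unfolding induced_def by blast

lemma card_P3s_cycle4:
  assumes cyc: "cycle4 U a b c d"
  shows "card (P3s U) = 4"
proof -
  have dist: "distinct [a, b, c, d]" and U: "U = {a, b, c, d}"
    using induced_distinct[OF cyc] induced_set[OF cyc] by simp_all
  have adj: "(a, b) \<in> E" "(b, c) \<in> E" "(c, d) \<in> E" "(a, d) \<in> E" "(a, c) \<notin> E" "(b, d) \<notin> E"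
    using adj_induced[OF cyc] U dist by auto
  have ne: "{a, b, c} \<noteq> {a, b, d}" "{a, b, c} \<noteq> {a, c, d}" "{a, b, c} \<noteq> {b, c, d}"
     "{a, b, d} \<noteq> {a, c, d}" "{a, b, d} \<noteq> {b, c, d}" "{a, c, d} \<noteq> {b, c, d}"
    using dist by (auto simp: set_eq_iff)
  show ?thesis
    unfolding U card_P3s_4[OF dist] using ne dist adj by (simp add: mem_P3s)
qed

lemma card_P3s_pan:
  assumes pan: "pan U a b c d e"
  shows "card (P3s U) = 6"
proof -
  have dist: "distinct [a, b, c, d, e]" and U: "U = {a, b, c, d, e}"
    using induced_distinct[OF pan] induced_set[OF pan] by simp_all
  let ?W = "set [a, b, c, d]"
  have cyc: "cycle4 ?W a b c d"
    using dist U by (intro induced_restrict[OF pan]) auto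
  have ins: "U = insert e ?W" "e \<notin> ?W" using U dist by auto
  have "nbrs U e = {a}" using nbrs_induced[OF pan, of e] U dist by auto
  then have ne: "nbrs ?W e = {a}" using nbrs_insert_self ins by metis
  have "nbrs ?W a = {b, d}" using nbrs_induced[OF cyc, of a] dist by auto
  then show ?thesis
    using card_P3s_insert[of ?W e] card_P3s_cycle4[OF cyc] card_P3s_at_1[OF ins(2) ne] dist ins by simp
qed

lemma card_P3s_house:
  assumes house: "house U a b c d e"
  shows "card (P3s U) = 6"
proof -
  have dist: "distinct [a, b, c, d, e]" and U: "U = {a, b, c, d, e}"
    using induced_distinct[OF house] induced_set[OF house] by simp_all
  let ?W = "set [a, c, d, e]"
  have cyc: "cycle4 ?W a c d e"
    using dist U by (intro induced_restrict[OF house]) auto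
  have ins: "U = insert b ?W" "b \<notin> ?W" using U dist by auto
  have "nbrs U b = {a, c}" using nbrs_induced[OF house, of b] U dist by auto
  then have nb: "nbrs ?W b = {a, c}" using nbrs_insert_self ins by metis
  have "(a, c) \<in> E" "nbrs ?W a = {c, e}" "nbrs ?W c = {a, d}"
    using adj_induced[OF cyc, of a c] nbrs_induced[OF cyc, of a] nbrs_induced[OF cyc, of c] dist by auto
  then show ?thesis
    using card_P3s_insert[of ?W b] card_P3s_cycle4[OF cyc] card_P3s_at_2_adjacent[OF ins(2) _ nb] dist ins by simp
qed

lemma card_P3s_chorded_hexagon:
  assumes hex: "chorded_hexagon U a b c d e f"
  shows "card (P3s U) = 10"
proof -
  have dist: "distinct [a, b, c, d, e, f]" and U: "U = {a, b, c, d, e, f}"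
    using induced_distinct[OF hex] induced_set[OF hex] by simp_all
  let ?W = "set [a, b, c, d, f]"
  have pan: "pan ?W a b c d f"
    using dist U by (intro induced_restrict[OF hex]) auto
  have ins: "U = insert e ?W" "e \<notin> ?W" using U dist by auto
  have "nbrs U e = {d, f}" using nbrs_induced[OF hex, of e] U dist by auto
  then have ne: "nbrs ?W e = {d, f}" using nbrs_insert_self ins by metis
  have "(d, f) \<notin> E" "nbrs ?W d = {a, c}" "nbrs ?W f = {a}"
    using adj_induced[OF pan, of d f] nbrs_induced[OF pan, of d] nbrs_induced[OF pan, of f] dist by auto
  then show ?thesis
    using card_P3s_insert[of ?W e] card_P3s_pan[OF pan] card_P3s_at_2_nonadjacent[OF ins(2) _ ne] dist ins by simp
qed

lemma card_P3s_star:
  assumes star: "star U z" and "finite U"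
  shows "card (P3s U) = (card U - 1) choose 2"
proof -
  let ?L = "U - {z}"
  have z: "z \<in> U" and EU: "E \<inter> U \<times> U = {z} \<times> ?L \<union> ?L \<times> {z}" using star by (auto simp: star_def)
  have adj: "(x, y) \<in> E \<longleftrightarrow> x = z \<and> y \<noteq> z \<or> y = z \<and> x \<noteq> z" if "x \<in> U" "y \<in> U" for x y
    using EU that by blast
  have "P3s U = insert z ` {T. T \<subseteq> ?L \<and> card T = 2}"
  proof
    show "P3s U \<subseteq> insert z ` {T. T \<subseteq> ?L \<and> card T = 2}"
    proof
      fix S assume "S \<in> P3s U"
      then obtain x y w where S: "S = {x, y, w}" "x \<noteq> w" "(x, y) \<in> E" "(y, w) \<in> E" "(x, w) \<notin> E" "x \<in> U" "y \<in> U" "w \<in> U"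
        unfolding P3s_def by auto
      then have "y = z" "x \<noteq> z" "w \<noteq> z" using adj by metis+
      then have "S = insert z {x, w}" "{x, w} \<subseteq> ?L" "card {x, w} = 2" using S by auto
      then show "S \<in> insert z ` {T. T \<subseteq> ?L \<and> card T = 2}" by blast
    qed
    show "insert z ` {T. T \<subseteq> ?L \<and> card T = 2} \<subseteq> P3s U"
    proof
      fix S assume "S \<in> insert z ` {T. T \<subseteq> ?L \<and> card T = 2}"
      then obtain x w where "S = {x, z, w}" "x \<noteq> w" "x \<in> ?L" "w \<in> ?L"
        by (auto simp: card_2_iff)
      moreover have "(x, z) \<in> E" "(z, w) \<in> E" "(x, w) \<notin> E" "{x, z, w} \<subseteq> U" using calculation adj z by auto
      ultimately show "S \<in> P3s U" unfolding P3s_def by blast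
    qed
  qed
  moreover have "inj_on (insert z) {T. T \<subseteq> ?L \<and> card T = 2}"
    by (rule inj_onI) blast
  ultimately have "card (P3s U) = card {T. T \<subseteq> ?L \<and> card T = 2}" by (simp add: card_image)
  also have "\<dots> = card ?L choose 2" using assms(2) by (intro n_subsets) simp
  finally show ?thesis using z assms(2) by simp
qed

end

section \<open>Vertices of low degree\<close>

text \<open>
  The two configurations that an outerplanar drawing excludes. The vertex set is not part of the
  locale, so that the results apply to all finite vertex sets alike.
\<close>
locale outerplanar_adjacency = adjacency E for E :: "'a rel" +
  assumes theta_free: "chain (a # P @ [b]) \<Longrightarrow> chain (a # Q @ [b]) \<Longrightarrow> chain (a # R @ [b]) \<Longrightarrow>
      distinct (a # b # P @ Q @ R) \<Longrightarrow> P \<noteq> [] \<Longrightarrow> Q \<noteq> [] \<Longrightarrow> R \<noteq> [] \<Longrightarrow> False"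
    and crossing_free: "chain (a # P @ b # Q @ x # R @ d # S @ [a]) \<Longrightarrow>
      distinct (a # P @ b # Q @ x # R @ d # S) \<Longrightarrow> (a, x) \<in> E \<Longrightarrow> (b, d) \<in> E \<Longrightarrow> False"
begin

lemma chain_rev: "chain (rev xs) = chain xs"
  using sym_E by (metis (mono_tags, lifting) successively_mono successively_rev)

lemma chain_Cons_append: "chain (x # P @ [y]) \<Longrightarrow> chain (y # zs) \<Longrightarrow> chain (x # P @ y # zs)"
  by (induction P arbitrary: x) (auto simp: successively_Cons)

lemma chain_infix: "chain (xs @ ys @ zs) \<Longrightarrow> chain ys"
  by (simp add: successively_append_iff)

text \<open>
  Among the longest paths in \<open>U\<close> that end with the edge from \<open>u\<close> to \<open>x\<close>, consider one whose first vertex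
  \<open>a\<close> has a neighbour \<open>w\<close>, other than its successor, as early as possible on the path. All neighbours of
  \<open>a\<close> lie on the path. Reversing the part before \<open>w\<close> yields another longest path, which starts with the
  predecessor \<open>b\<close> of \<open>w\<close>. If both \<open>a\<close> and \<open>b\<close> had three neighbours, then by minimality each would
  have one beyond \<open>w\<close>, say \<open>e\<close> and \<open>d\<close>. If \<open>d\<close> is not beyond \<open>e\<close>, then the edges from \<open>a\<close> to \<open>w\<close> and
  from \<open>b\<close> to \<open>d\<close> are crossing chords of the cycle closed by \<open>e\<close>; otherwise three paths join \<open>b\<close> to
  \<open>e\<close>. Fixing the last edge is what allows the conclusion to avoid two prescribed vertices.
\<close>
lemma low_degree_vertex_off_edge:
  assumes fin: "finite U" and ux: "u \<in> U" "x \<in> U" "(u, x) \<in> E" and y: "y \<in> U" "y \<noteq> x" "(u, y) \<in> E"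
  shows "\<exists>v \<in> U - {u, x}. card (nbrs U v) \<le> 2"
proof (rule ccontr)
  assume neg: "\<not> ?thesis"
  define good where "good v \<longleftrightarrow> distinct v \<and> chain v \<and> set v \<subseteq> U \<and> suffix [u, x] v" for v
  have "u \<noteq> x" "u \<noteq> y" using ux y irrefl_E by auto
  then have g0: "good [y, u, x]"
    using ux y sym_E by (auto simp: good_def suffix_def)
  have bound: "length v < Suc (card U)" if "good v" for v
    using that fin by (metis good_def card_mono distinct_card le_imp_less_Suc)
  obtain L where L: "good L" "\<And>v. good v \<Longrightarrow> length v \<le> length L"
    using ex_has_greatest_nat[of good "[y, u, x]" length "Suc (card U)"] g0 bound by blast
  define longest where "longest v \<longleftrightarrow> good v \<and> length v = length L" for v
  have L3: "3 \<le> length L" using L(2)[OF g0] by simp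
  \<comment> \<open>A longest path cannot be prolonged at its first vertex, so all neighbours of that vertex lie on it.\<close>
  have third: "\<exists>e \<in> set r. (a, e) \<in> E \<and> e \<noteq> s \<and> e \<noteq> t" if lon: "longest (a # r)" for a r s t
  proof -
    obtain W where W: "a # r = W @ [u, x]" using lon by (auto simp: longest_def good_def suffix_def)
    have "W \<noteq> []" using W lon L3 by (auto simp: longest_def)
    then have "a \<noteq> u" "a \<noteq> x" "a \<in> U" using W lon by (cases W; auto simp: longest_def good_def)+
    then have "\<not> card (nbrs U a) \<le> 2" using neg by auto
    then have "\<not> nbrs U a \<subseteq> {s, t}"
      using card_mono[of "{s, t}" "nbrs U a"] card_insert_le_m1[of 2 "{t}" s] by auto
    then obtain e where e: "e \<in> U" "(a, e) \<in> E" "e \<noteq> s" "e \<noteq> t" by (auto simp: nbrs_def)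
    have "e \<in> set r"
    proof (rule ccontr)
      assume "e \<notin> set r"
      then have "good (e # a # r)"
        using lon e irrefl_E sym_E by (auto simp: longest_def good_def suffix_Cons)
      then show False using L(2) lon by (fastforce simp: longest_def)
    qed
    then show ?thesis using e by auto
  qed
  have no_chord: False if "longest (a # P @ b # w # M)" "(a, w) \<in> E" for a P b w M
    using that
  proof (induction "length P" arbitrary: a P b w M rule: less_induct)
    case less
    \<comment> \<open>A neighbour of the first vertex before \<open>w'\<close> would be a shorter chord, against the induction.\<close>
    have shorter: "f \<in> set M'" if lon: "longest (a' # P' @ b' # w' # M')" "length P' = length P" and aw: "(a', w') \<in> E"
      and f: "(a', f) \<in> E" "f \<in> set (P' @ b' # w' # M')" "f \<noteq> hd (P' @ [b'])" "f \<noteq> w'" for a' P' b' w' M' f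
    proof (rule ccontr)
      assume "f \<notin> set M'"
      then have "f \<in> set (P' @ [b'])" using f by auto
      then obtain P1 P2 where P: "P' @ [b'] = P1 @ f # P2" by (meson split_list)
      then have "P1 \<noteq> []" using f(3) by (cases P1) auto
      then obtain P3 b3 where P3: "P1 = P3 @ [b3]" by (metis rev_exhaust)
      have len: "length P3 < length P" using arg_cong[OF P, of length] P3 lon(2) by simp
      have "a' # P' @ b' # w' # M' = a' # P3 @ b3 # f # (P2 @ w' # M')"
        using P P3 by (metis append.assoc append_Cons append_Nil)
      then show False using less.hyps[OF len] lon f(1) by metis
    qed
    have good: "good (a # P @ b # w # M)" using less.prems by (simp add: longest_def)
    obtain e where e: "e \<in> set (P @ b # w # M)" "(a, e) \<in> E" "e \<noteq> hd (P @ [b])" "e \<noteq> w"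
      using third[OF less.prems(1), of "hd (P @ [b])" w] by blast
    have eM: "e \<in> set M" using shorter[OF less.prems(1) refl less.prems(2) e(2,1,3,4)] .
    have chs: "chain (a # P @ [b])" "chain (w # M)" "(b, w) \<in> E"
      using good chain_infix[of "[]" "a # P @ [b]" "w # M"] chain_infix[of "a # P @ [b]" "w # M" "[]"]
        chain_infix[of "a # P" "[b, w]" "M"] by (auto simp: good_def)
    have "suffix [u, x] (w # M)"
    proof (rule suffix_length_suffix)
      show "suffix [u, x] (a # P @ b # w # M)" using good by (simp add: good_def)
      show "suffix (w # M) (a # P @ b # w # M)" by (simp add: suffix_def)
      show "length [u, x] \<le> length (w # M)" using eM by (cases M) auto
    qed
    then have suf: "suffix [u, x] (b # rev P @ a # w # M)" using suffix_appendI[of "[u, x]" "w # M" "b # rev P @ [a]"] by simp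
    have "chain (b # rev P @ [a])" using chs(1) chain_rev[of "a # P @ [b]"] by simp
    then have "chain (b # rev P @ a # w # M)"
      using chain_Cons_append[of b "rev P" a "w # M"] chs(2) less.prems(2) by simp
    then have rot: "longest (b # rev P @ a # w # M)"
      using less.prems(1) suf by (auto simp: longest_def good_def)
    obtain d where d: "d \<in> set (rev P @ a # w # M)" "(b, d) \<in> E" "d \<noteq> hd (rev P @ [a])" "d \<noteq> w"
      using third[OF rot, of "hd (rev P @ [a])" w] by blast
    have dM: "d \<in> set M" using shorter[OF rot _ chs(3) d(2,1,3,4)] by simp
    obtain M1 M2 where M: "M = M1 @ e # M2" using eM by (meson split_list)
    have dist: "distinct (a # P @ b # w # M)" using good by (simp add: good_def)
    \<comment> \<open>\<open>last (d # S) = e\<close> allows \<open>d = e\<close>, in which case \<open>S\<close> is empty.\<close>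
    have cross: False if "M = R @ d # S @ T" "last (d # S) = e" for R S T
    proof (rule crossing_free[of a P b "[]" w R d S])
      have "chain (w # R @ d # S)" using chs(2) that(1) chain_infix[of "[]" "w # R @ d # S" T] by simp
      moreover have "last (w # R @ d # S) = e" using that(2) by simp
      ultimately have "chain ((w # R @ d # S) @ [a])"
        using sym_E e(2) by (subst successively_append_iff) auto
      then show "chain (a # P @ b # [] @ w # R @ d # S @ [a])"
        using chain_Cons_append[OF chs(1), of "w # R @ d # S @ [a]"] chs(3) by simp
      show "distinct (a # P @ b # [] @ w # R @ d # S)" using dist that(1) by auto
    qed (use less.prems(2) d in auto)
    consider "d \<in> set M1" | "d = e" | "d \<in> set M2" using dM M by auto
    then show False
    proof cases
      case 1
      then obtain R S where "M1 = R @ d # S" by (meson split_list)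
      then show False using cross[of R "S @ [e]" M2] M by simp
    next
      case 2
      then show False using cross[of M1 "[]" M2] M by simp
    next
      case 3
      then obtain N1 N2 where N: "M2 = N1 @ d # N2" by (meson split_list)
      show False
      proof (rule theta_free[of b "w # M1" e "rev P @ [a]" "d # rev N1"])
        show "chain (b # (w # M1) @ [e])"
          using chs chain_infix[of "[]" "w # M1 @ [e]" M2] M by simp
        show "chain (b # (rev P @ [a]) @ [e])"
          using \<open>chain (b # rev P @ [a])\<close> chain_Cons_append[of b "rev P" a "[e]"] e(2) by simp
        have "chain (e # N1 @ [d])" using chs(2) chain_infix[of "w # M1" "e # N1 @ [d]" N2] M N by simp
        then show "chain (b # (d # rev N1) @ [e])" using chain_rev[of "e # N1 @ [d]"] d(2) by simp
        show "distinct (b # e # (w # M1) @ (rev P @ [a]) @ d # rev N1)" using dist M N by auto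
      qed auto
    qed
  qed
  obtain a b' r where ab: "L = a # b' # r" using L3 by (cases L; cases "tl L") auto
  have lonL: "longest (a # b' # r)" using L(1) ab by (simp add: longest_def)
  obtain w where w: "w \<in> set (b' # r)" "(a, w) \<in> E" "w \<noteq> b'" using third[OF lonL, of b' b'] by blast
  then obtain P0 M where r: "r = P0 @ w # M" by (auto dest: split_list)
  obtain P b where "b' # P0 = P @ [b]" by (metis append_butlast_last_id list.distinct(1))
  then have "a # b' # r = a # P @ b # w # M" using r by (metis append.assoc append_Cons append_Nil)
  then show False using no_chord lonL w(2) by metis
qed

lemma low_degree_vertex:
  assumes "finite U" "U \<noteq> {}"
  shows "\<exists>v \<in> U. card (nbrs U v) \<le> 2"
proof (rule ccontr)
  assume neg: "\<not> ?thesis"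
  obtain u where u: "u \<in> U" using assms by auto
  have "\<not> card (nbrs U u) \<le> 2" using neg u by auto
  then have "1 < card (nbrs U u)" by linarith
  then obtain x y where "x \<in> nbrs U u" "y \<in> nbrs U u" "x \<noteq> y"
    using assms(1) by (metis card_le_Suc0_iff_eq finite_nbrs not_less One_nat_def)
  then show False
    using low_degree_vertex_off_edge[of U u x y] assms u neg by (auto simp: nbrs_def)
qed

text \<open>
  A third common neighbour would make three paths of length two.
\<close>
lemma two_common_nbrs:
  assumes "u \<noteq> w" "finite W" "v \<notin> W" "u \<in> W" "w \<in> W" "(v, u) \<in> E" "(v, w) \<in> E"
  shows "card (nbrs W u \<inter> nbrs W w) \<le> 1"
proof (rule ccontr)
  assume "\<not> ?thesis"
  then obtain x y where xy: "x \<in> nbrs W u \<inter> nbrs W w" "y \<in> nbrs W u \<inter> nbrs W w" "x \<noteq> y"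
    using assms(2) by (metis card_le_Suc0_iff_eq finite_Int finite_nbrs One_nat_def)
  show False
  proof (rule theta_free[of u "[v]" w "[x]" "[y]"])
    show "distinct (u # w # [v] @ [x] @ [y])" using assms xy irrefl_E by (auto simp: nbrs_def)
  qed (use assms xy sym_E in \<open>auto simp: nbrs_def\<close>)
qed

lemma card_P3s_at_1_le:
  assumes "v \<notin> W" "finite W" "nbrs W v = {u}"
  shows "card (P3s_at (insert v W) v) \<le> card W - 1"
proof -
  have "u \<in> W" "nbrs W u \<subseteq> W - {u}" using assms irrefl_E by (auto simp: nbrs_def)
  then have "card (nbrs W u) \<le> card W - 1" using assms(2) by (metis card_Diff_singleton card_mono finite_Diff)
  then show ?thesis using card_P3s_at_1[OF assms(1,3)] by simp
qed

lemma card_P3s_at_2_adjacent_le: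
  assumes "v \<notin> W" "finite W" "nbrs W v = {u, w}" "(u, w) \<in> E"
  shows "card (P3s_at (insert v W) v) \<le> card W - 1"
proof -
  let ?A = "nbrs W u - {w}" and ?B = "nbrs W w - {u}"
  have uw: "u \<in> W" "w \<in> W" "u \<noteq> w" "(v, u) \<in> E" "(v, w) \<in> E" using assms irrefl_E by (auto simp: nbrs_def)
  have "card (P3s_at (insert v W) v) = card (?A \<union> ?B) + card (?A \<inter> ?B)"
    unfolding card_P3s_at_2_adjacent[OF assms] by (rule card_Un_Int) (simp_all add: assms(2))
  also have "card (?A \<inter> ?B) \<le> 1"
    using two_common_nbrs[OF uw(3) assms(2,1) uw(1,2,4,5)] card_mono[of "nbrs W u \<inter> nbrs W w" "?A \<inter> ?B"] assms(2) by fastforce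
  also have "card (?A \<union> ?B) \<le> card (W - {u, w})"
    using assms(2) irrefl_E by (intro card_mono) (auto simp: nbrs_def)
  also have "card (W - {u, w}) = card W - 2" using uw assms(2) by (simp add: card_Diff_subset)
  finally have le: "card (P3s_at (insert v W) v) \<le> card W - 2 + 1" by simp
  have "card {u, w} \<le> card W" using uw assms(2) by (intro card_mono) auto
  then show ?thesis using le uw by simp
qed

text \<open>
  The count is one more than the sum of two degrees, and by \<open>two_common_nbrs\<close> the two
  neighbourhoods overlap in at most one vertex, so it exceeds \<open>card W - 1\<close> only in this extreme
  position.
\<close>
lemma card_P3s_at_2_nonadjacent_ge:
  assumes "v \<notin> W" "finite W" "nbrs W v = {u, w}" "(u, w) \<notin> E" "u \<noteq> w"
    and t: "card W \<le> card (P3s_at (insert v W) v)"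
  obtains x where "nbrs W u \<union> nbrs W w = W - {u, w}" "nbrs W u \<inter> nbrs W w = {x}"
proof -
  let ?A = "nbrs W u" and ?B = "nbrs W w"
  have uw: "u \<in> W" "w \<in> W" "(v, u) \<in> E" "(v, w) \<in> E" using assms(3) by (auto simp: nbrs_def)
  have "card (P3s_at (insert v W) v) = 1 + (card (?A \<union> ?B) + card (?A \<inter> ?B))"
    unfolding card_P3s_at_2_nonadjacent[OF assms(1-5)] add.assoc
    by (rule arg_cong[of _ _ "(+) 1"], rule card_Un_Int) (simp_all add: assms(2))
  moreover have i: "card (?A \<inter> ?B) \<le> 1" using two_common_nbrs[OF assms(5,2,1) uw] .
  moreover have sub: "?A \<union> ?B \<subseteq> W - {u, w}" using assms(4) sym_E irrefl_E by (auto simp: nbrs_def)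
  moreover have c: "card (W - {u, w}) = card W - 2" using uw assms(2,5) by (simp add: card_Diff_subset)
  moreover have "card {u, w} \<le> card W" using uw assms(2) by (intro card_mono) auto
  moreover have "card (?A \<union> ?B) \<le> card (W - {u, w})" using sub assms(2) by (intro card_mono) auto
  ultimately have "card (?A \<inter> ?B) = 1" "card (?A \<union> ?B) = card (W - {u, w})" using t assms(5) by auto
  then show thesis using that sub assms(2) by (metis card_1_singletonE card_subset_eq finite_Diff)
qed

text \<open>
  The deletion step for \<open>insert v W\<close>: with \<open>n = card W + 1\<close>, the bound on the copies through v is
  the difference \<open>n - 2\<close> of the two binomial coefficients.
\<close>
definition removable :: "'a set \<Rightarrow> 'a \<Rightarrow> bool" where
  "removable W v \<longleftrightarrow> v \<notin> W \<and> card (nbrs W v) \<le> 2 \<and> card (P3s_at (insert v W) v) \<le> card W - 1"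

lemma removable_if_adjacent_nbrs:
  assumes "finite W" "v \<notin> W" "card (nbrs W v) \<le> 2" "u \<in> nbrs W v" "\<And>w. w \<in> nbrs W v \<Longrightarrow> w = u \<or> (u, w) \<in> E"
  shows "removable W v"
proof -
  have "finite (nbrs W v)" using assms(1) by simp
  with assms(3) have "card (P3s_at (insert v W) v) \<le> card W - 1"
  proof (cases rule: small_set_cases)
    case 1 then show ?thesis using assms(4) by simp
  next
    case (2 a) then show ?thesis using card_P3s_at_1_le assms by blast
  next
    case (3 a b)
    then have "(a, b) \<in> E" using assms(4,5) sym_E by auto
    then show ?thesis using card_P3s_at_2_adjacent_le assms(1,2) 3 by blast
  qed
  then show ?thesis using assms by (simp add: removable_def)
qed

text \<open>
  Let v, u, w and x form the exceptional position. Some vertex other than x is adjacent to u or to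
  w, because \<open>W\<close> has more than three elements; say to u. Applied to u and its neighbours with the
  edge from u to x, \<open>low_degree_vertex_off_edge\<close> gives a neighbour z of u with at most two
  neighbours in that set. It has no others: an edge from z to a neighbour of w would complete a
  third path from u to w. So every neighbour of z is u or adjacent to u.
\<close>
lemma removable_vertex:
  assumes U: "finite U" "5 \<le> card U"
  obtains v W where "U = insert v W" "removable W v"
proof -
  have "U \<noteq> {}" using U by auto
  then obtain v where v: "v \<in> U" "card (nbrs U v) \<le> 2" using low_degree_vertex U by blast
  define W where "W = U - {v}"
  have W: "U = insert v W" "v \<notin> W" "finite W" using v U by (auto simp: W_def)
  have cW: "card W \<ge> 4" using U W by simp
  have dv: "card (nbrs W v) \<le> 2" using v(2) W nbrs_insert_self by metis
  show thesis
  proof (cases "removable W v")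
    case True then show thesis using that W by blast
  next
    case False
    then have t: "card W \<le> card (P3s_at (insert v W) v)" using W dv by (auto simp: removable_def)
    have "finite (nbrs W v)" using W by simp
    with dv obtain u w where uw: "nbrs W v = {u, w}" "u \<noteq> w"
    proof (cases rule: small_set_cases)
      case 1 then show thesis using card_P3s_at_0[OF W(2)] t cW by simp
    next
      case (2 u) then show thesis using card_P3s_at_1_le[OF W(2,3)] t cW by fastforce
    qed
    have nE: "(u, w) \<notin> E" using card_P3s_at_2_adjacent_le[OF W(2,3) uw(1)] t cW by fastforce
    obtain x where x: "nbrs W u \<union> nbrs W w = W - {u, w}" "nbrs W u \<inter> nbrs W w = {x}"
      using card_P3s_at_2_nonadjacent_ge[OF W(2,3) uw(1) nE uw(2) t] .
    have other: "\<exists>z X. U = insert z X \<and> removable X z"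
      if uw: "nbrs W v = {u, w}" "u \<noteq> w" "(u, w) \<notin> E" and x: "nbrs W u \<union> nbrs W w = W - {u, w}" "nbrs W u \<inter> nbrs W w = {x}"
        and y: "y \<in> nbrs W u" "y \<noteq> x" for u w x y
    proof -
      let ?S = "insert u (nbrs W u)"
      have xu: "x \<in> nbrs W u" "(u, x) \<in> E" "(w, x) \<in> E" "(u, y) \<in> E" "u \<in> W" "w \<in> W" "x \<in> W" "(v, u) \<in> E" "(v, w) \<in> E"
        using x(2) y uw(1) by (auto simp: nbrs_def)
      obtain z where z: "z \<in> ?S - {u, x}" "card (nbrs ?S z) \<le> 2"
        using low_degree_vertex_off_edge[of ?S u x y] xu y W(3) by auto
      have zW: "z \<in> W" "(u, z) \<in> E" "z \<noteq> u" "z \<noteq> x" using z(1) by (auto simp: nbrs_def)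
      have zw: "(z, w) \<notin> E" using x(2) zW sym_E by (auto simp: nbrs_def)
      have "z \<noteq> w" using zW uw(3) by auto
      have zv: "(z, v) \<notin> E" using uw(1) zW \<open>z \<noteq> w\<close> sym_E by (auto simp: nbrs_def)
      have "nbrs U z \<subseteq> ?S"
      proof
        fix q assume q: "q \<in> nbrs U z"
        show "q \<in> ?S"
        proof (rule ccontr)
          assume nq: "q \<notin> ?S"
          have qz: "(z, q) \<in> E" "q \<in> W" using q zv W by (auto simp: nbrs_def)
          then have "q \<in> nbrs W w" using x(1) nq zw by auto
          then have qw: "(q, w) \<in> E" using sym_E by (auto simp: nbrs_def)
          have qu: "(u, q) \<notin> E" using nq qz by (auto simp: nbrs_def)
          show False
          proof (rule theta_free[of u "[v]" w "[x]" "[z, q]"])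
            show "distinct (u # w # [v] @ [x] @ [z, q])"
              using uw(2) xu zW qz W(2) nq \<open>z \<noteq> w\<close> qw irrefl_E qu by auto
          qed (use xu zW qz qw sym_E in auto)
        qed
      qed
      then have nS: "nbrs U z = nbrs ?S z" using W xu by (auto simp: nbrs_def)
      have Uz: "U = insert z (U - {z})" using zW W by auto
      have nz: "nbrs (U - {z}) z = nbrs ?S z" using nS irrefl_E by (auto simp: nbrs_def)
      have "removable (U - {z}) z"
      proof (rule removable_if_adjacent_nbrs)
        show "u \<in> nbrs (U - {z}) z" unfolding nz using zW sym_E by (auto simp: nbrs_def)
        show "\<And>q. q \<in> nbrs (U - {z}) z \<Longrightarrow> q = u \<or> (u, q) \<in> E" unfolding nz by (auto simp: nbrs_def)
      qed (use U z nz in auto)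
      then show ?thesis using Uz by blast
    qed
    have "card {u, w, x} \<le> 3" by (simp add: card_insert_if)
    then have "\<not> W \<subseteq> {u, w, x}" using cW card_mono[of "{u, w, x}" W] by auto
    then obtain y where "y \<in> W" "y \<notin> {u, w, x}" by auto
    then have "y \<in> nbrs W u \<or> y \<in> nbrs W w" "y \<noteq> x" using x(1) by auto
    moreover have "nbrs W v = {w, u}" "w \<noteq> u" "(w, u) \<notin> E" "nbrs W w \<union> nbrs W u = W - {w, u}"
      "nbrs W w \<inter> nbrs W u = {x}"
      using uw nE x sym_E by blast+
    ultimately have "\<exists>z X. U = insert z X \<and> removable X z"
      using other[OF uw nE x] other[of w u x y] by blast
    then show thesis using that by blast
  qed
qed

section \<open>Extremal vertex sets\<close>

lemma induced_reorder:
  assumes "induced U xs F" "mset ys = mset xs" "F' \<union> F'\<inverse> = F \<union> F\<inverse>"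
  shows "induced U ys F'"
  using assms mset_eq_setD[OF assms(2)] mset_eq_imp_distinct_iff[OF assms(2)] unfolding induced_def by metis

lemma cycle4_rotate: "cycle4 U a b c d \<Longrightarrow> cycle4 U b c d a"
  by (erule induced_reorder) auto

lemma cycle4_reflect: "cycle4 U a b c d \<Longrightarrow> cycle4 U a d c b"
  by (erule induced_reorder) auto

text \<open>
  With at most three copies through the deleted vertex, six copies need three or four on the
  remaining four vertices, that is, a star or a four-cycle. A new vertex on a four-cycle lies in at
  most two copies, since its neighbours cannot be opposite.
\<close>
lemma five_vertices:
  assumes U: "card U = 5"
  shows "card (P3s U) \<le> 6"
    and "card (P3s U) = 6 \<Longrightarrow> (\<exists>a b c d e. pan U a b c d e) \<or> (\<exists>a b c d e. house U a b c d e) \<or> (\<exists>z. star U z)"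
proof -
  have "finite U" using U by (simp add: card_ge_0_finite)
  then obtain v W where W: "U = insert v W" "removable W v" using removable_vertex[of U] U by auto
  have v: "v \<notin> W" "card (nbrs W v) \<le> 2" and t: "card (P3s_at (insert v W) v) \<le> card W - 1"
    using W(2) by (auto simp: removable_def)
  have fW: "finite W" and cW: "card W = 4" using \<open>finite U\<close> U W(1) v by auto
  have N: "card (P3s U) = card (P3s W) + card (P3s_at (insert v W) v)"
    unfolding W(1) using fW v(1) by (rule card_P3s_insert)
  have fn: "finite (nbrs W v)" using fW by simp
  have "card (P3s U) \<le> 6 \<and> (card (P3s U) = 6 \<longrightarrow> (\<exists>a b c d e. pan U a b c d e) \<or> (\<exists>a b c d e. house U a b c d e) \<or> (\<exists>z. star U z))"
  proof (cases "card (P3s W) = 4")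
    case True
    then obtain a b c d where cyc: "cycle4 W a b c d" using four_vertices(2)[OF cW] by blast
    \<comment> \<open>By symmetry a neighbour of v may be taken as the first vertex of the cycle.\<close>
    have rot: "\<exists>b c d. cycle4 W u b c d" if "u \<in> W" for u
    proof -
      have "W = set [a, b, c, d]" by (rule induced_set[OF cyc])
      then have "u = a \<or> u = b \<or> u = c \<or> u = d" using that by simp
      moreover note rot1 = cycle4_rotate[OF cyc]
      moreover note rot2 = cycle4_rotate[OF rot1]
      moreover note rot3 = cycle4_rotate[OF rot2]
      ultimately show ?thesis using cyc by (elim disjE) (simp only:, blast)+
    qed
    show ?thesis
      using v(2) fn
    proof (cases rule: small_set_cases)
      case 1
      then show ?thesis using True N card_P3s_at_0[OF v(1)] by simp
    next
      case (2 u)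
      then have "u \<in> W" by (auto simp: nbrs_def)
      then obtain b c d where cyc: "cycle4 W u b c d" using rot by blast
      have d: "distinct [u, b, c, d]" "W = set [u, b, c, d]" using induced_distinct[OF cyc] induced_set[OF cyc] by blast+
      have "nbrs W u = {b, d}" using nbrs_induced[OF cyc] d by auto
      then have "card (P3s_at (insert v W) v) = 2" using card_P3s_at_1[OF v(1) 2] d by simp
      moreover have "pan U u b c d v" unfolding W(1)
        using d v(1) by (intro induced_insert[OF cyc v(1) 2]) auto
      ultimately show ?thesis using True N by auto
    next
      case (3 u w)
      then have uw: "u \<in> W" "w \<in> W" "(v, u) \<in> E" "(v, w) \<in> E" by (auto simp: nbrs_def)
      obtain b c d where cyc0: "cycle4 W u b c d" using rot uw by blast
      then have "W = set [u, b, c, d]" by (rule induced_set)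
      then have "w = b \<or> w = c \<or> w = d" using uw 3 by simp
      then obtain c d where "cycle4 W u w c d \<or> (\<exists>b. cycle4 W u b w d)"
        using cyc0 cycle4_reflect by metis
      then show ?thesis
      proof (elim disjE exE)
        assume cyc: "cycle4 W u w c d"
        have d: "distinct [u, w, c, d]" "W = set [u, w, c, d]" using induced_distinct[OF cyc] induced_set[OF cyc] by blast+
        have "nbrs W u = {w, d}" "nbrs W w = {u, c}" "(u, w) \<in> E"
          using nbrs_induced[OF cyc] adj_induced[OF cyc] d by auto
        then have "card (P3s_at (insert v W) v) = 2" using card_P3s_at_2_adjacent[OF v(1) fW 3(1)] d by simp
        moreover have "house U u v w c d" unfolding W(1)
          using d v(1) by (intro induced_insert[OF cyc v(1) 3(1)]) auto
        ultimately show ?thesis using True N by auto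
      next
        fix b assume cyc: "cycle4 W u b w d"
        have d: "distinct [u, b, w, d]" "W = set [u, b, w, d]" using induced_distinct[OF cyc] induced_set[OF cyc] by blast+
        have "nbrs W u = {b, d}" "nbrs W w = {b, d}" using nbrs_induced[OF cyc] d by auto
        then have False using two_common_nbrs[OF 3(2) fW v(1) uw] d by simp
        then show ?thesis ..
      qed
    qed
  next
    case False
    then have le3: "card (P3s W) \<le> 3" using four_vertices(1)[OF cW] by linarith
    show ?thesis
    proof (intro conjI impI)
      show "card (P3s U) \<le> 6" using le3 N t cW by simp
      assume "card (P3s U) = 6"
      then have "card (P3s W) = 3" "card W - 1 \<le> card (P3s_at (insert v W) v)" using le3 N t cW by auto
      moreover obtain z where z: "star W z" using four_vertices(3)[OF cW] calculation by blast
      ultimately consider "star (insert v W) z" | k l where "nbrs W v = {k, l}" "k \<noteq> l" "k \<noteq> z" "l \<noteq> z"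
        using star_extend[OF z fW _ v] cW by auto
      then show "(\<exists>a b c d e. pan U a b c d e) \<or> (\<exists>a b c d e. house U a b c d e) \<or> (\<exists>z. star U z)"
      proof cases
        case 1 then show ?thesis using W by auto
      next
        case 2
        have zkl: "z \<in> W" "k \<in> W" "l \<in> W" using z 2(1) by (auto simp: star_def nbrs_def)
        have "card (W - {z, k, l}) = 1" using zkl 2 cW fW by (simp add: card_Diff_subset)
        then obtain m where m: "W - {z, k, l} = {m}" by (auto simp: card_1_singleton_iff)
        then have Wm: "W = set [z, k, l, m]" "distinct [z, k, l, m]" using zkl 2 by auto
        have "W - {z} = {k, l, m}" using Wm by auto
        then have ind: "induced W [z, k, l, m] {(z, k), (z, l), (z, m)}"
          using z Wm unfolding induced_def star_def by auto
        have "pan U z k v l m" unfolding W(1)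
          using Wm v(1) by (intro induced_insert[OF ind v(1) 2(1)]) auto
        then show ?thesis by blast
      qed
    qed
  qed
  then show "card (P3s U) \<le> 6"
    and "card (P3s U) = 6 \<Longrightarrow> (\<exists>a b c d e. pan U a b c d e) \<or> (\<exists>a b c d e. house U a b c d e) \<or> (\<exists>z. star U z)"
    by blast+
qed

lemma extend_low_degree:
  assumes W: "finite W" "v \<notin> W" "card (nbrs W v) \<le> 2" and t: "k \<le> card (P3s_at (insert v W) v)"
    and deg: "\<And>x. x \<in> W \<Longrightarrow> card (nbrs W x) < k" and k: "0 < k"
  obtains u w where "u \<noteq> w" "u \<in> W" "w \<in> W" "nbrs W v = {u, w}"
proof -
  have "finite (nbrs W v)" using W by simp
  with W(3) show thesis
  proof (cases rule: small_set_cases)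
    case 1 then show thesis using card_P3s_at_0[OF W(2)] t k by simp
  next
    case (2 u)
    then have "u \<in> W" by (auto simp: nbrs_def)
    then show thesis using card_P3s_at_1[OF W(2) 2] t deg by fastforce
  next
    case (3 u w)
    then have "u \<in> W" "w \<in> W" by (auto simp: nbrs_def)
    then show thesis using that 3 by blast
  qed
qed

text \<open>
  Of the ten pairs of neighbours, those joining the pendant vertex to \<open>b\<close> or \<open>d\<close> close the hexagon.
  Adjacent pairs give fewer than four copies, and the other pairs give a third path between two
  vertices.
\<close>
lemma pan_extend:
  assumes pan: "pan W a b c d e" and v: "v \<notin> W" "card (nbrs W v) \<le> 2"
    and t: "card (P3s_at (insert v W) v) = 4"
  shows "\<exists>a b c d e f. chorded_hexagon (insert v W) a b c d e f"
proof -
  have dist: "distinct [a, b, c, d, e]" and Ws: "W = set [a, b, c, d, e]" using induced_distinct[OF pan] induced_set[OF pan] by blast+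
  have fW: "finite W" using Ws by simp
  have nb: "nbrs W a = {b, d, e}" "nbrs W b = {a, c}" "nbrs W c = {b, d}" "nbrs W d = {a, c}" "nbrs W e = {a}"
    using nbrs_induced[OF pan] Ws dist by auto
  have adj: "(a, b) \<in> E" "(a, d) \<in> E" "(a, e) \<in> E" "(b, c) \<in> E" "(c, d) \<in> E"
    "(a, c) \<notin> E" "(b, d) \<notin> E" "(b, e) \<notin> E" "(d, e) \<notin> E" "(c, e) \<notin> E"
    using adj_induced[OF pan] Ws dist by auto
  have "\<forall>x \<in> set [a, b, c, d, e]. card (nbrs W x) < 4" using nb dist by simp
  then obtain u w where uw: "u \<noteq> w" "u \<in> W" "w \<in> W" "nbrs W v = {u, w}"
    using extend_low_degree[OF fW v, of 4] t unfolding Ws[symmetric] by auto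
  have "u = a \<or> u = b \<or> u = c \<or> u = d \<or> u = e" "w = a \<or> w = b \<or> w = c \<or> w = d \<or> w = e"
    using uw(2,3) Ws by simp_all
  then have "{u, w} \<in> {{a, b}, {a, c}, {a, d}, {a, e}, {b, c}, {b, d}, {b, e}, {c, d}, {c, e}, {d, e}}"
    using uw(1) by (elim disjE) (simp_all add: insert_commute)
  then show ?thesis
    unfolding uw(4)[symmetric] insert_iff
  proof (elim disjE emptyE, goal_cases)
    case 1 then show ?thesis using card_P3s_at_2_adjacent[OF v(1) fW 1] adj nb dist t by simp
  next
    case 2
    then have "(v, a) \<in> E" "(v, c) \<in> E" by (auto simp: nbrs_def)
    moreover have "nbrs W a \<inter> nbrs W c = {b, d}" using nb dist by auto
    ultimately show ?thesis using two_common_nbrs[OF _ fW v(1), of a c] Ws dist by simp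
  next
    case 3 then show ?thesis using card_P3s_at_2_adjacent[OF v(1) fW 3] adj nb dist t by simp
  next
    case 4 then show ?thesis using card_P3s_at_2_adjacent[OF v(1) fW 4] adj nb dist t by simp
  next
    case 5 then show ?thesis using card_P3s_at_2_adjacent[OF v(1) fW 5] adj nb dist t by simp
  next
    case 6
    then have "(v, b) \<in> E" "(v, d) \<in> E" by (auto simp: nbrs_def)
    moreover have "nbrs W b \<inter> nbrs W d = {a, c}" using nb dist by auto
    ultimately show ?thesis using two_common_nbrs[OF _ fW v(1), of b d] Ws dist by simp
  next
    case 7
    have "chorded_hexagon (insert v W) a d c b v e"
      using dist Ws v(1) by (intro induced_insert[OF pan v(1) 7]) auto
    then show ?thesis by blast
  next
    case 8 then show ?thesis using card_P3s_at_2_adjacent[OF v(1) fW 8] adj nb dist t by simp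
  next
    case 9
    then have "(v, c) \<in> E" "(v, e) \<in> E" by (auto simp: nbrs_def)
    then have False
      using theta_free[of a "[b]" c "[d]" "[e, v]"] adj dist v(1) Ws sym_E by auto
    then show ?thesis ..
  next
    case 10
    have "chorded_hexagon (insert v W) a b c d v e"
      using dist Ws v(1) by (intro induced_insert[OF pan v(1) 10]) auto
    then show ?thesis by blast
  qed
qed

text \<open>
  Only the pair \<open>a\<close>, \<open>c\<close> of neighbours gives exactly four copies, and it creates three paths from
  \<open>a\<close> to \<open>c\<close>.
\<close>
lemma house_extend:
  assumes house: "house W a b c d e" and v: "v \<notin> W" "card (nbrs W v) \<le> 2"
    and t: "card (P3s_at (insert v W) v) = 4"
  shows False
proof -
  have dist: "distinct [a, b, c, d, e]" and Ws: "W = set [a, b, c, d, e]" using induced_distinct[OF house] induced_set[OF house] by blast+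
  have fW: "finite W" using Ws by simp
  have nb: "nbrs W a = {b, c, e}" "nbrs W b = {a, c}" "nbrs W c = {a, b, d}" "nbrs W d = {c, e}" "nbrs W e = {a, d}"
    using nbrs_induced[OF house] Ws dist by auto
  have adj: "(a, b) \<in> E" "(b, c) \<in> E" "(c, d) \<in> E" "(d, e) \<in> E" "(a, e) \<in> E" "(a, c) \<in> E"
    "(a, d) \<notin> E" "(b, d) \<notin> E" "(b, e) \<notin> E" "(c, e) \<notin> E"
    using adj_induced[OF house] Ws dist by auto
  have "\<forall>x \<in> set [a, b, c, d, e]. card (nbrs W x) < 4" using nb dist by simp
  then obtain u w where uw: "u \<noteq> w" "u \<in> W" "w \<in> W" "nbrs W v = {u, w}"
    using extend_low_degree[OF fW v, of 4] t unfolding Ws[symmetric] by auto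
  have "u = a \<or> u = b \<or> u = c \<or> u = d \<or> u = e" "w = a \<or> w = b \<or> w = c \<or> w = d \<or> w = e"
    using uw(2,3) Ws by simp_all
  then have "{u, w} \<in> {{a, b}, {a, c}, {a, d}, {a, e}, {b, c}, {b, d}, {b, e}, {c, d}, {c, e}, {d, e}}"
    using uw(1) by (elim disjE) (simp_all add: insert_commute)
  then show False
    unfolding uw(4)[symmetric] insert_iff
  proof (elim disjE emptyE, goal_cases)
    case 1 then show ?thesis using card_P3s_at_2_adjacent[OF v(1) fW 1] adj nb dist t by simp
  next
    case 2
    then have "(v, a) \<in> E" "(v, c) \<in> E" by (auto simp: nbrs_def)
    then show False
      using theta_free[of a "[b]" c "[v]" "[e, d]"] adj dist v(1) Ws sym_E by auto
  next
    case 3 then show ?thesis using card_P3s_at_2_nonadjacent[OF v(1) fW 3] adj nb dist t by simp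
  next
    case 4 then show ?thesis using card_P3s_at_2_adjacent[OF v(1) fW 4] adj nb dist t by simp
  next
    case 5 then show ?thesis using card_P3s_at_2_adjacent[OF v(1) fW 5] adj nb dist t by simp
  next
    case 6 then show ?thesis using card_P3s_at_2_nonadjacent[OF v(1) fW 6] adj nb dist t by simp
  next
    case 7 then show ?thesis using card_P3s_at_2_nonadjacent[OF v(1) fW 7] adj nb dist t by simp
  next
    case 8 then show ?thesis using card_P3s_at_2_adjacent[OF v(1) fW 8] adj nb dist t by simp
  next
    case 9 then show ?thesis using card_P3s_at_2_nonadjacent[OF v(1) fW 9] adj nb dist t by simp
  next
    case 10 then show ?thesis using card_P3s_at_2_adjacent[OF v(1) fW 10] adj nb dist t by simp
  qed
qed

text \<open>
  Adjacent pairs of neighbours give at most four copies, nonadjacent pairs that contain an end of the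
  chord give six. The remaining pairs give exactly five, but also three paths between them.
\<close>
lemma chorded_hexagon_extend:
  assumes hex: "chorded_hexagon W a b c d e f" and v: "v \<notin> W" "card (nbrs W v) \<le> 2"
    and t: "card (P3s_at (insert v W) v) = 5"
  shows False
proof -
  have dist: "distinct [a, b, c, d, e, f]" and Ws: "W = set [a, b, c, d, e, f]" using induced_distinct[OF hex] induced_set[OF hex] by blast+
  have fW: "finite W" using Ws by simp
  have nb: "nbrs W a = {b, d, f}" "nbrs W b = {a, c}" "nbrs W c = {b, d}" "nbrs W d = {a, c, e}"
    "nbrs W e = {d, f}" "nbrs W f = {a, e}"
    using nbrs_induced[OF hex] Ws dist by auto
  have adj: "(a, b) \<in> E" "(b, c) \<in> E" "(c, d) \<in> E" "(d, e) \<in> E" "(e, f) \<in> E" "(a, f) \<in> E" "(a, d) \<in> E"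
    "(a, c) \<notin> E" "(a, e) \<notin> E" "(b, d) \<notin> E" "(b, e) \<notin> E" "(b, f) \<notin> E" "(c, e) \<notin> E" "(c, f) \<notin> E" "(d, f) \<notin> E"
    using adj_induced[OF hex] Ws dist by auto
  have "\<forall>x \<in> set [a, b, c, d, e, f]. card (nbrs W x) < 5" using nb dist by simp
  then obtain u w where uw: "u \<noteq> w" "u \<in> W" "w \<in> W" "nbrs W v = {u, w}"
    using extend_low_degree[OF fW v, of 5] t unfolding Ws[symmetric] by auto
  have edge: False if kl: "nbrs W v = {k, l}" "(k, l) \<in> {(a, b), (b, c), (c, d), (d, e), (e, f), (a, f), (a, d)}" for k l
  proof -
    have "(k, l) \<in> E" using kl(2) adj by auto
    then show ?thesis using card_P3s_at_2_adjacent[OF v(1) fW kl(1)] kl(2) nb dist t by auto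
  qed
  have far: False if kl: "nbrs W v = {k, l}" "(k, l) \<in> {(a, c), (a, e), (b, d), (d, f)}" for k l
  proof -
    have "(k, l) \<notin> E" "k \<noteq> l" using kl(2) adj dist by auto
    then show ?thesis using card_P3s_at_2_nonadjacent[OF v(1) fW kl(1)] kl(2) nb dist t by auto
  qed
  have theta: False if "nbrs W v = {b, e} \<or> nbrs W v = {b, f} \<or> nbrs W v = {c, e} \<or> nbrs W v = {c, f}"
    using that
  proof (elim disjE, goal_cases)
    case 1
    then have "(v, b) \<in> E" "(v, e) \<in> E" by (auto simp: nbrs_def)
    then show False using theta_free[of b "[v]" e "[c, d]" "[a, f]"] adj dist v(1) Ws sym_E by auto
  next
    case 2
    then have "(v, b) \<in> E" "(v, f) \<in> E" by (auto simp: nbrs_def)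
    then show False using theta_free[of b "[v]" f "[a]" "[c, d, e]"] adj dist v(1) Ws sym_E by auto
  next
    case 3
    then have "(v, c) \<in> E" "(v, e) \<in> E" by (auto simp: nbrs_def)
    then show False using theta_free[of c "[v]" e "[d]" "[b, a, f]"] adj dist v(1) Ws sym_E by auto
  next
    case 4
    then have "(v, c) \<in> E" "(v, f) \<in> E" by (auto simp: nbrs_def)
    then show False using theta_free[of c "[v]" f "[b, a]" "[d, e]"] adj dist v(1) Ws sym_E by auto
  qed
  have "u = a \<or> u = b \<or> u = c \<or> u = d \<or> u = e \<or> u = f" "w = a \<or> w = b \<or> w = c \<or> w = d \<or> w = e \<or> w = f"
    using uw(2,3) Ws by simp_all
  then have "{u, w} \<in> {{a, b}, {b, c}, {c, d}, {d, e}, {e, f}, {a, f}, {a, d}, {a, c}, {a, e}, {b, d}, {d, f},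
      {b, e}, {b, f}, {c, e}, {c, f}}"
    using uw(1) by (elim disjE) (simp_all add: insert_commute)
  then show False
    unfolding uw(4)[symmetric] insert_iff
    by (elim disjE emptyE) ((erule edge, simp; fail) | (erule far, simp; fail) | (rule theta, simp; fail))+
qed

lemma removable_decomposition:
  assumes "finite U" "5 \<le> card U"
  obtains v W where "U = insert v W" "finite W" "card W = card U - 1" "v \<notin> W" "card (nbrs W v) \<le> 2"
    "card (P3s_at (insert v W) v) \<le> card U - 2" "card (P3s U) = card (P3s W) + card (P3s_at (insert v W) v)"
proof -
  obtain v W where W: "U = insert v W" "removable W v" using removable_vertex[OF assms] .
  then have v: "v \<notin> W" by (simp add: removable_def)
  have fW: "finite W" using assms(1) W by simp
  show thesis
    using that[OF W(1) fW _ v] W v fW card_P3s_insert[OF fW v] by (simp add: removable_def)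
qed

lemma choose_two_step:
  assumes "2 \<le> n" shows "(n - 1) choose 2 = ((n - 2) choose 2) + (n - 2)"
proof -
  obtain m where "n = Suc (Suc m)" using assms by (metis add_2_eq_Suc le_Suc_ex)
  then show ?thesis by (simp add: numeral_2_eq_2)
qed

lemma card_P3s_le:
  assumes "finite U" "5 \<le> card U"
  shows "card (P3s U) \<le> (card U - 1) choose 2"
  using assms
proof (induction "card U" arbitrary: U rule: less_induct)
  case less
  show ?case
  proof (cases "card U = 5")
    case True then show ?thesis using five_vertices(1) by (simp add: choose_two)
  next
    case False
    obtain v W where W: "U = insert v W" "finite W" "card W = card U - 1"
      "card (P3s_at (insert v W) v) \<le> card U - 2" "card (P3s U) = card (P3s W) + card (P3s_at (insert v W) v)"
      using removable_decomposition[OF less.prems] by metis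
    have "card (P3s W) \<le> (card U - 2) choose 2"
      using less.hyps[of W] W less.prems False by (simp add: numeral_2_eq_2)
    moreover have "(card U - 1) choose 2 = ((card U - 2) choose 2) + (card U - 2)"
      using choose_two_step[of "card U"] less.prems by simp
    ultimately show ?thesis using W by linarith
  qed
qed

lemma extremal_six:
  assumes "card U = 6" "card (P3s U) = 10"
  shows "(\<exists>z. star U z) \<or> (\<exists>a b c d e f. chorded_hexagon U a b c d e f)"
proof -
  have "finite U" using assms by (simp add: card_ge_0_finite)
  moreover have "5 \<le> card U" using assms by simp
  ultimately obtain v W where W: "U = insert v W" "finite W" "card W = card U - 1" "v \<notin> W" "card (nbrs W v) \<le> 2"
    "card (P3s_at (insert v W) v) \<le> card U - 2" "card (P3s U) = card (P3s W) + card (P3s_at (insert v W) v)"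
    by (rule removable_decomposition)
  have W5: "card W = 5" using W(3) assms(1) by simp
  have eq: "card (P3s W) = 6" "card (P3s_at (insert v W) v) = 4"
    using five_vertices(1)[OF W5] W(6,7) assms by auto
  have "star (insert v W) z" if "star W z" for z
    using star_extend[OF that W(2) _ W(4,5)] eq W5 by auto
  then show ?thesis
    using five_vertices(2)[OF W5 eq(1)] pan_extend[OF _ W(4,5) eq(2)] house_extend[OF _ W(4,5) eq(2)] W(1)
    by metis
qed

lemma extremal_star:
  assumes "7 \<le> card U" "card (P3s U) = (card U - 1) choose 2"
  shows "\<exists>z. star U z"
  using assms
proof (induction "card U" arbitrary: U rule: less_induct)
  case less
  have "finite U" using less.prems by (metis card.infinite not_numeral_le_zero)
  moreover have "5 \<le> card U" using less.prems by simp
  ultimately obtain v W where W: "U = insert v W" "finite W" "card W = card U - 1" "v \<notin> W" "card (nbrs W v) \<le> 2"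
    "card (P3s_at (insert v W) v) \<le> card U - 2" "card (P3s U) = card (P3s W) + card (P3s_at (insert v W) v)"
    by (rule removable_decomposition)
  have ch: "(card U - 1) choose 2 = ((card W - 1) choose 2) + (card U - 2)"
    using choose_two_step[of "card U"] less.prems(1) W(3) by (simp add: diff_diff_add numeral_2_eq_2)
  have "card (P3s W) \<le> (card W - 1) choose 2" using card_P3s_le[OF W(2)] W(3) less.prems by simp
  then have eq: "card (P3s W) = (card W - 1) choose 2" "card (P3s_at (insert v W) v) = card U - 2"
    using W(6,7) less.prems(2) ch by auto
  have "\<exists>z. star W z"
  proof (cases "card U = 7")
    case True
    then have "card W = 6" "card (P3s W) = 10" using eq W(3) by (auto simp: choose_two)
    moreover have "card (P3s_at (insert v W) v) = 5" using eq(2) True by simp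
    ultimately show ?thesis
      using extremal_six[of W] chorded_hexagon_extend[OF _ W(4,5)] by metis
  next
    case False
    then show ?thesis using less.hyps[of W] less.prems W(3) eq by auto
  qed
  then obtain z where z: "star W z" by blast
  have "5 \<le> card W" "card W - 1 \<le> card (P3s_at (insert v W) v)" using eq(2) W(3) less.prems(1) by linarith+
  then show ?case
    using star_extend[OF z W(2) _ W(4,5)] W(1) by auto
qed

end

section \<open>Isomorphism with a graph on an initial segment of the naturals\<close>

text \<open>
  An isomorphism of graphs without parallel edges is determined by its action on the vertices.
\<close>
lemma graph_iso_iff:
  "graph_iso G H \<longleftrightarrow> pair_wf_digraph G \<and>
     (\<exists>f. inj_on f (pverts G) \<and> pverts H = f ` pverts G \<and> parcs H = map_prod f f ` parcs G)"
  (is "?L \<longleftrightarrow> ?R")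
proof
  assume ?L
  then obtain h where h: "pre_digraph.digraph_isomorphism (with_proj G) h" "with_proj H = app_iso h (with_proj G)"
    unfolding digraph_iso_def by blast
  have wf: "wf_digraph (with_proj G)" using h(1) by (simp add: pre_digraph.digraph_isomorphism_def)
  let ?f = "iso_verts h"
  have ends: "iso_tail h = fst" "iso_head h = snd"
    using arg_cong[OF h(2), of tail] arg_cong[OF h(2), of head] by simp_all
  have arcs: "iso_arcs h e = map_prod ?f ?f e" if "e \<in> parcs G" for e
    using h(1) that ends by (cases e; cases "iso_arcs h e") (force simp: pre_digraph.digraph_isomorphism_def)
  have "pverts H = ?f ` pverts G" "parcs H = iso_arcs h ` parcs G"
    using arg_cong[OF h(2), of verts] arg_cong[OF h(2), of arcs] by simp_all
  moreover have "iso_arcs h ` parcs G = map_prod ?f ?f ` parcs G" using arcs by (rule image_cong[OF refl])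
  moreover have "inj_on ?f (pverts G)" using h(1) by (simp add: pre_digraph.digraph_isomorphism_def)
  moreover have "pair_wf_digraph G" using wf by (simp add: wf_digraph_wp_iff)
  ultimately show ?R by auto
next
  assume R: ?R
  then obtain f where f: "inj_on f (pverts G)" "pverts H = f ` pverts G" "parcs H = map_prod f f ` parcs G" by auto
  interpret pair_wf_digraph G using R by blast
  define h where "h = \<lparr>iso_verts = f, iso_arcs = map_prod f f, iso_head = snd, iso_tail = fst\<rparr>"
  have "inj_on (map_prod f f) (parcs G)"
    by (rule inj_on_subset[OF map_prod_inj_on[OF f(1) f(1)]]) (auto dest: in_arcsD1 in_arcsD2)
  then have "pre_digraph.digraph_isomorphism (with_proj G) h"
    using f(1) by (auto simp: pre_digraph.digraph_isomorphism_def h_def) (unfold_locales)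
  moreover have "with_proj H = app_iso h (with_proj G)"
    using f by (simp add: app_iso_def h_def with_proj_def)
  ultimately show ?L unfolding digraph_iso_def by blast
qed

lemma graph_iso_nat_iff:
  fixes H :: "nat pair_pre_digraph"
  assumes H: "pverts H = {..<k}" "parcs H \<subseteq> {..<k} \<times> {..<k}" 
  shows "graph_iso G H \<longleftrightarrow> (\<exists>xs. length xs = k \<and> distinct xs \<and> pverts G = set xs \<and>
    parcs G = (\<lambda>(i, j). (xs ! i, xs ! j)) ` parcs H)" (is "_ \<longleftrightarrow> ?R")
proof
  assume "graph_iso G H"
  then obtain f where wf: "pair_wf_digraph G" and f: "inj_on f (pverts G)" "{..<k} = f ` pverts G" "parcs H = map_prod f f ` parcs G"
    using H(1) unfolding graph_iso_iff by auto
  interpret pair_wf_digraph G by (rule wf)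
  define g where "g = inv_into (pverts G) f"
  define xs where "xs = map g [0..<k]"
  have bij: "bij_betw f (pverts G) {..<k}" using f by (simp add: bij_betw_def)
  then have g: "bij_betw g {..<k} (pverts G)" unfolding g_def by (rule bij_betw_inv_into)
  have gf: "g (f v) = v" if "v \<in> pverts G" for v using f(1) that by (simp add: g_def)
  have nth: "xs ! i = g i" if "i < k" for i using that by (simp add: xs_def)
  have "set xs = g ` {..<k}" unfolding xs_def by (auto simp: atLeast0LessThan)
  then have "pverts G = set xs" using g by (simp add: bij_betw_def)
  moreover have "distinct xs" using g by (simp add: xs_def distinct_map bij_betw_def atLeast0LessThan)
  moreover have "parcs G = (\<lambda>(i, j). (xs ! i, xs ! j)) ` parcs H"
  proof -
    have "(\<lambda>(i, j). (xs ! i, xs ! j)) ` parcs H = (\<lambda>(i, j). (g i, g j)) ` parcs H"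
      using H(2) nth by (intro image_cong) auto
    also have "\<dots> = (\<lambda>e. e) ` parcs G"
      unfolding f(3) image_image by (intro image_cong) (auto intro!: gf dest: in_arcsD1 in_arcsD2)
    finally show ?thesis by simp
  qed
  ultimately show ?R by (intro exI[of _ xs]) (simp add: xs_def)
next
  assume ?R
  then obtain xs where xs: "length xs = k" "distinct xs" "pverts G = set xs"
    "parcs G = (\<lambda>(i, j). (xs ! i, xs ! j)) ` parcs H" by auto
  define f where "f = inv_into {..<k} ((!) xs)"
  have inj: "inj_on ((!) xs) {..<k}" using xs(1,2) by (simp add: inj_on_nth)
  have im: "(!) xs ` {..<k} = set xs" using xs(1) by (auto simp: set_conv_nth)
  have bij: "bij_betw f (set xs) {..<k}" unfolding f_def using inj im by (intro bij_betw_inv_into) (simp add: bij_betw_def)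
  have ff: "f (xs ! i) = i" if "i < k" for i using inj that by (simp add: f_def)
  have "map_prod f f ` parcs G = (\<lambda>e. e) ` parcs H"
    unfolding xs(4) image_image using H(2) ff by (intro image_cong) auto
  moreover have "pair_wf_digraph G"
    using xs H(2) by unfold_locales auto
  ultimately show "graph_iso G H"
    unfolding graph_iso_iff using bij xs(3) H(1) by (auto simp: bij_betw_def intro!: exI[of _ f])
qed

lemma ex_list_0: "(\<exists>xs. length xs = 0 \<and> Q xs) \<longleftrightarrow> Q []"
  by auto

lemma ex_list_Suc: "(\<exists>xs. length xs = Suc n \<and> Q xs) \<longleftrightarrow> (\<exists>x xs. length xs = n \<and> Q (x # xs))"
  by (metis length_Suc_conv)

lemma ex_list_3: "(\<exists>xs. length xs = 3 \<and> Q xs) \<longleftrightarrow> (\<exists>a b c. Q [a, b, c])"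
  and ex_list_4: "(\<exists>xs. length xs = 4 \<and> Q xs) \<longleftrightarrow> (\<exists>a b c d. Q [a, b, c, d])"
  and ex_list_5: "(\<exists>xs. length xs = 5 \<and> Q xs) \<longleftrightarrow> (\<exists>a b c d e. Q [a, b, c, d, e])"
  and ex_list_6: "(\<exists>xs. length xs = 6 \<and> Q xs) \<longleftrightarrow> (\<exists>a b c d e f. Q [a, b, c, d, e, f])"
  by (simp_all only: eval_nat_numeral BitM.simps numeral_One One_nat_def ex_list_Suc ex_list_0)

lemma adjacency_parcs:
  assumes "pair_graph G" shows "adjacency (parcs G)"
proof -
  interpret pair_graph G by (rule assms)
  show ?thesis using arcs_symmetric no_loops' by unfold_locales auto
qed

text \<open>
  This is the only passage from drawings to combinatorics.
\<close>
lemma outerplanar_adjacency_parcs: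
  assumes "outerplanar G" shows "outerplanar_adjacency (parcs G)"
proof -
  obtain p c where "pair_graph G" "planar_drawing G p c" "p ` pverts G \<subseteq> frontier (outside (drawing_image G p c))"
    using assms unfolding outerplanar_def by blast
  then interpret D: outer_drawing G p c by (rule outer_drawing.intro)
  show ?thesis
  proof
    show "\<And>x y. (x, y) \<in> parcs G \<Longrightarrow> (y, x) \<in> parcs G" by (rule D.arc_sym)
    show "\<And>x. (x, x) \<notin> parcs G" using D.arc_neq by blast
  qed (rule D.theta_free D.crossing_free; assumption)+
qed

lemma ind_copies_path3:
  assumes "pair_graph G"
  shows "ind_copies (path_graph 3) G = card (adjacency.P3s (parcs G) (pverts G))"
proof -
  interpret pair_graph G by (rule assms)
  interpret A: adjacency "parcs G" using assms by (rule adjacency_parcs)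
  have P: "pverts (path_graph 3) = {..<3}" "parcs (path_graph 3) = {(0, 1), (1, 0), (1, 2), (2, 1)}"
    by (auto simp: path_graph_def)
  have "digraph_iso (induce_subgraph (with_proj G) S) (with_proj (path_graph 3)) \<longleftrightarrow>
      (\<exists>a b c. S = {a, b, c} \<and> a \<noteq> c \<and> (a, b) \<in> parcs G \<and> (b, c) \<in> parcs G \<and> (a, c) \<notin> parcs G)"
    if "S \<subseteq> pverts G" for S
  proof -
    let ?GS = "\<lparr>pverts = S, parcs = {e \<in> parcs G. fst e \<in> S \<and> snd e \<in> S}\<rparr>"
    have ind: "induce_subgraph (with_proj G) S = with_proj ?GS"
      by (simp add: induce_subgraph_def with_proj_def)
    have "digraph_iso (induce_subgraph (with_proj G) S) (with_proj (path_graph 3)) \<longleftrightarrow>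
      (\<exists>xs. length xs = 3 \<and> distinct xs \<and> S = set xs \<and> {e \<in> parcs G. fst e \<in> S \<and> snd e \<in> S} =
        (\<lambda>(i, j). (xs ! i, xs ! j)) ` {(0, 1), (1, 0), (1, 2), (2, 1)})"
      unfolding ind using graph_iso_nat_iff[of "path_graph 3" 3 ?GS] P by simp
    also have "\<dots> \<longleftrightarrow> (\<exists>a b c. distinct [a, b, c] \<and> S = {a, b, c} \<and>
       {e \<in> parcs G. fst e \<in> S \<and> snd e \<in> S} = {(a, b), (b, a), (b, c), (c, b)})"
      unfolding ex_list_3 by simp
    also have "\<dots> \<longleftrightarrow> (\<exists>a b c. S = {a, b, c} \<and> a \<noteq> c \<and> (a, b) \<in> parcs G \<and> (b, c) \<in> parcs G \<and> (a, c) \<notin> parcs G)"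
      (is "?X \<longleftrightarrow> ?Y")
    proof
      assume ?X
      then obtain a b c where d: "distinct [a, b, c]" and S: "S = {a, b, c}" and
        e: "{e \<in> parcs G. fst e \<in> S \<and> snd e \<in> S} = {(a, b), (b, a), (b, c), (c, b)}" by blast
      have "(x, y) \<in> parcs G \<longleftrightarrow> (x, y) \<in> {(a, b), (b, a), (b, c), (c, b)}" if "x \<in> S" "y \<in> S" for x y
        unfolding e[symmetric] using that by simp
      from this[of a b] this[of b c] this[of a c]
      have "(a, b) \<in> parcs G" "(b, c) \<in> parcs G" "(a, c) \<notin> parcs G" using d S by auto
      then show ?Y using d S by auto
    next
      assume ?Y
      then obtain a b c where abc: "S = {a, b, c}" "a \<noteq> c" "(a, b) \<in> parcs G" "(b, c) \<in> parcs G" "(a, c) \<notin> parcs G" by blast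
      have "a \<noteq> b" "b \<noteq> c" using abc A.irrefl_E by auto
      moreover have "(b, a) \<in> parcs G" "(c, b) \<in> parcs G" "(c, a) \<notin> parcs G" using abc A.sym_E by blast+
      moreover have "{e \<in> parcs G. fst e \<in> S \<and> snd e \<in> S} = {(a, b), (b, a), (b, c), (c, b)}"
        unfolding abc(1) using abc(2-5) calculation A.irrefl_E by auto
      ultimately show ?X using abc by auto
    qed
    finally show ?thesis .
  qed
  then have "{S. S \<subseteq> pverts G \<and> digraph_iso (induce_subgraph (with_proj G) S) (with_proj (path_graph 3))} = A.P3s (pverts G)"
    unfolding A.P3s_def by auto
  then show ?thesis by (simp add: ind_copies_def)
qed

lemma graph_iso_induced:
  fixes H :: "nat pair_pre_digraph"
  assumes H: "pverts H = {..<k}" "parcs H = F \<union> F\<inverse>" "F \<subseteq> {..<k} \<times> {..<k}" and irrefl: "\<And>i. (i, i) \<notin> F"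
  shows "graph_iso G H \<longleftrightarrow> pair_graph G \<and>
    (\<exists>xs. length xs = k \<and> adjacency.induced (parcs G) (pverts G) xs ((\<lambda>(i, j). (xs ! i, xs ! j)) ` F))"
proof -
  have im: "(\<lambda>(i, j). (xs ! i, xs ! j)) ` (F \<union> F\<inverse>) =
      (\<lambda>(i, j). (xs ! i, xs ! j)) ` F \<union> ((\<lambda>(i, j). (xs ! i, xs ! j)) ` F)\<inverse>" for xs :: "'b list"
    by force
  have sub: "parcs H \<subseteq> {..<k} \<times> {..<k}" using H(2,3) by auto
  have pg: "pair_graph G" if xs: "length xs = k" "distinct xs" "pverts G = set xs"
      "parcs G = (\<lambda>(i, j). (xs ! i, xs ! j)) ` parcs H" for xs
  proof -
    have in_V: "parcs G \<subseteq> pverts G \<times> pverts G" using xs sub by auto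
    have "finite (parcs G)" using in_V xs(3) by (metis List.finite_set finite_SigmaI finite_subset)
    moreover have "(x, x) \<notin> parcs G" for x
    proof
      assume "(x, x) \<in> parcs G"
      then obtain i j where ij: "(i, j) \<in> parcs H" "xs ! i = xs ! j" using xs(4) by auto
      then have "(i, j) \<in> F \<union> F\<inverse>" "i < k" "j < k" using H(2) sub by auto
      then have "(i, i) \<in> F \<union> F\<inverse>" using xs(1,2) ij(2) by (auto simp: nth_eq_iff_index_eq)
      then show False using irrefl by auto
    qed
    moreover have "sym (parcs G)" unfolding xs(4) H(2) im by (rule sym_Un_converse)
    ultimately show ?thesis using in_V xs(3)
      by unfold_locales (auto simp: symmetric_def)
  qed
  have "graph_iso G H \<longleftrightarrow> pair_graph G \<and> (\<exists>xs. length xs = k \<and> distinct xs \<and> pverts G = set xs \<and>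
    parcs G = (\<lambda>(i, j). (xs ! i, xs ! j)) ` parcs H)"
    unfolding graph_iso_nat_iff[OF H(1) sub] using pg by blast
  also have "\<dots> \<longleftrightarrow> pair_graph G \<and>
    (\<exists>xs. length xs = k \<and> adjacency.induced (parcs G) (pverts G) xs ((\<lambda>(i, j). (xs ! i, xs ! j)) ` F))"
  proof (intro conj_cong refl)
    assume G: "pair_graph G"
    interpret pair_graph G by (rule G)
    interpret A: adjacency "parcs G" using G by (rule adjacency_parcs)
    have "parcs G \<inter> pverts G \<times> pverts G = parcs G" by (auto dest: in_arcsD1 in_arcsD2)
    then show "(\<exists>xs. length xs = k \<and> distinct xs \<and> pverts G = set xs \<and> parcs G = (\<lambda>(i, j). (xs ! i, xs ! j)) ` parcs H)
      = (\<exists>xs. length xs = k \<and> A.induced (pverts G) xs ((\<lambda>(i, j). (xs ! i, xs ! j)) ` F))"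
      unfolding A.induced_def H(2) im by simp
  qed
  finally show ?thesis .
qed

section \<open>Outerplanar drawings on a parabola\<close>

definition parabola :: "real \<Rightarrow> complex" where
  "parabola t = Complex t (t\<^sup>2)"

text \<open>
  The height of a chord above the parabola is the product of the horizontal distances to the
  two ends, which turns the intersection of chords into an equation between products.
\<close>
lemma parabola_chord:
  assumes "z \<in> closed_segment (parabola s) (parabola t)" "s \<le> t"
  shows "s \<le> Re z" "Re z \<le> t" "Im z - (Re z)\<^sup>2 = (Re z - s) * (t - Re z)"
proof -
  obtain u where u: "0 \<le> u" "u \<le> 1" "z = (1 - u) *\<^sub>R parabola s + u *\<^sub>R parabola t"
    using assms(1) by (auto simp: in_segment)
  have re: "Re z = s + u * (t - s)" and im: "Im z = s\<^sup>2 + u * (t\<^sup>2 - s\<^sup>2)"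
    unfolding u(3) parabola_def by (simp_all add: algebra_simps)
  show "s \<le> Re z" using u assms(2) re by simp
  show "Re z \<le> t"
    using mult_right_mono[OF u(2), of "t - s"] assms(2) re by simp
  show "Im z - (Re z)\<^sup>2 = (Re z - s) * (t - Re z)"
    unfolding re im by (simp add: power2_eq_square algebra_simps)
qed

lemma parabola_eq_iff: "z = parabola t \<longleftrightarrow> Re z = t \<and> Im z = t\<^sup>2"
  by (simp add: parabola_def complex_eq_iff)

lemma parabola_inject [simp]: "parabola s = parabola t \<longleftrightarrow> s = t"
  by (auto simp: parabola_def)

lemma parabola_chord_hits_parabola:
  assumes "parabola r \<in> closed_segment (parabola s) (parabola t)"
  shows "r = s \<or> r = t"
proof -
  have "r = s \<or> r = t" if "parabola r \<in> closed_segment (parabola s) (parabola t)" "s \<le> t" for s t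
    using parabola_chord(3)[OF that] by (auto simp: parabola_def)
  then show ?thesis using assms closed_segment_commute linear by metis
qed

text \<open>
  Two chords without crossing ends are nested or side by side. At a common point strictly above
  the parabola the two products would agree, but the one of the inner chord is smaller.
\<close>
lemma parabola_chords_meet:
  assumes z: "z \<in> closed_segment (parabola a) (parabola b)" "z \<in> closed_segment (parabola c) (parabola d)"
    and "a < b" "c < d" and neq: "(a, b) \<noteq> (c, d)" and nc: "\<not> (a < c \<and> c < b \<and> b < d)" "\<not> (c < a \<and> a < d \<and> d < b)"
  shows "\<exists>t \<in> {a, b} \<inter> {c, d}. z = parabola t"
proof -
  let ?x = "Re z"
  note A = parabola_chord[OF z(1)] and B = parabola_chord[OF z(2)]
  have A: "a \<le> ?x" "?x \<le> b" "Im z - ?x\<^sup>2 = (?x - a) * (b - ?x)" using A assms(3) by auto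
  have B: "c \<le> ?x" "?x \<le> d" "Im z - ?x\<^sup>2 = (?x - c) * (d - ?x)" using B assms(4) by auto
  have eq: "(?x - a) * (b - ?x) = (?x - c) * (d - ?x)" using A(3) B(3) by simp
  have zero: "(?x - a) * (b - ?x) = 0"
  proof (rule ccontr)
    assume nz: "(?x - a) * (b - ?x) \<noteq> 0"
    then have pos: "0 < ?x - a" "0 < b - ?x" using A by auto
    have "0 < (?x - c) * (d - ?x)" using pos eq by (metis mult_pos_pos)
    then have pos': "0 < ?x - c" "0 < d - ?x" using B by (auto simp: zero_less_mult_iff)
    consider "a \<le> c \<and> d \<le> b" | "c \<le> a \<and> b \<le> d" using nc pos pos' by linarith
    then show False
    proof cases
      case 1
      then have "a < c \<or> d < b" using neq by auto
      then have "(?x - c) * (d - ?x) < (?x - a) * (b - ?x)"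
        using 1 pos pos' by (auto intro: mult_strict_mono' mult_less_le_imp_less mult_le_less_imp_less)
      then show False using eq by simp
    next
      case 2
      then have "c < a \<or> b < d" using neq by auto
      then have "(?x - a) * (b - ?x) < (?x - c) * (d - ?x)"
        using 2 pos pos' by (auto intro: mult_strict_mono' mult_less_le_imp_less mult_le_less_imp_less)
      then show False using eq by simp
    qed
  qed
  then have "?x = a \<or> ?x = b" by auto
  moreover have "?x = c \<or> ?x = d" using zero eq by auto
  moreover have "z = parabola ?x" using A(3)[unfolded zero] by (simp add: parabola_eq_iff)
  ultimately show ?thesis by (intro bexI[of _ ?x]) auto
qed

lemma convex_parabola_region: "convex {z. (Re z)\<^sup>2 \<le> Im z}"
proof (rule convexI)
  fix z w :: complex and u v :: real
  assume zw: "z \<in> {z. (Re z)\<^sup>2 \<le> Im z}" "w \<in> {z. (Re z)\<^sup>2 \<le> Im z}" and u: "0 \<le> u" "0 \<le> v" "u + v = 1"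
  have v: "v = 1 - u" using u by simp
  have "(u * Re z + v * Re w)\<^sup>2 = u * (Re z)\<^sup>2 + v * (Re w)\<^sup>2 - u * v * (Re z - Re w)\<^sup>2"
    unfolding v by (simp add: power2_eq_square algebra_simps)
  also have "\<dots> \<le> u * (Re z)\<^sup>2 + v * (Re w)\<^sup>2" using u by simp
  also have "\<dots> \<le> u * Im z + v * Im w" using zw u by (intro add_mono mult_left_mono) auto
  finally show "u *\<^sub>R z + v *\<^sub>R w \<in> {z. (Re z)\<^sup>2 \<le> Im z}" by simp
qed

text \<open>
  The order given by \<open>f\<close> is the order of the vertices along the parabola. The set on and above
  the parabola is convex, so every point below it lies in the outer face, and such points come
  arbitrarily close to each vertex.
\<close>
theorem outerplanar_if_noncrossing:
  fixes f :: "'a \<Rightarrow> real"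
  assumes G: "pair_graph G" and inj: "inj_on f (pverts G)"
    and nc: "\<And>u v x y. (u, v) \<in> parcs G \<Longrightarrow> (x, y) \<in> parcs G \<Longrightarrow> \<not> (f u < f x \<and> f x < f v \<and> f v < f y)"
  shows "outerplanar G"
proof -
  define p where "p v = parabola (f v)" for v
  \<comment> \<open>A drawing assigns one arc to the unordered pair, so one of the two directions has to be chosen.\<close>
  define ends_of where "ends_of e = (SOME q. e = {fst q, snd q})" for e :: "'a set"
  define c where "c e = linepath (p (fst (ends_of e))) (p (snd (ends_of e)))" for e
  have basic: "u \<in> pverts G" "v \<in> pverts G" "u \<noteq> v" "(v, u) \<in> parcs G" if "(u, v) \<in> parcs G" for u v
  proof -
    interpret pair_graph G by (rule G)
    show "u \<in> pverts G" "v \<in> pverts G" "u \<noteq> v" "(v, u) \<in> parcs G"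
      using that no_loops' arcs_symmetric by (auto dest: in_arcsD1 in_arcsD2)
  qed
  have ends: "u \<in> pverts G" "v \<in> pverts G" "f u \<noteq> f v" if "(u, v) \<in> parcs G" for u v
    using basic[OF that] inj by (simp_all add: inj_on_eq_iff)
  have c: "c {u, v} = linepath (p u) (p v) \<or> c {u, v} = linepath (p v) (p u)" for u v
  proof -
    have "\<exists>q. {u, v} = {fst q, snd q}" by (intro exI[of _ "(u, v)"]) simp
    then have "{u, v} = {fst (ends_of {u, v}), snd (ends_of {u, v})}" unfolding ends_of_def by (rule someI_ex)
    then have "fst (ends_of {u, v}) = u \<and> snd (ends_of {u, v}) = v \<or> fst (ends_of {u, v}) = v \<and> snd (ends_of {u, v}) = u"
      unfolding doubleton_eq_iff by metis
    then show ?thesis unfolding c_def by metis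
  qed
  have im: "path_image (c {u, v}) = closed_segment (p u) (p v)" for u v
    using c[of u v] closed_segment_commute by (metis path_image_linepath)
  have injp: "inj_on p (pverts G)" using inj by (auto simp: inj_on_def p_def)
  have "planar_drawing G p c"
    unfolding planar_drawing_def
  proof (intro conjI ballI, goal_cases)
    case 1 show ?case by (rule injp)
  next
    case (2 e)
    obtain u v where e: "e = (u, v)" by (cases e)
    have uv: "(u, v) \<in> parcs G" using 2 e by simp
    have "p u \<noteq> p v" using ends[OF uv] by (simp add: p_def)
    then have "arc (c {u, v})" "{pathstart (c {u, v}), pathfinish (c {u, v})} = {p u, p v}"
      using c[of u v] by (auto simp: arc_linepath)
    moreover have "path_image (c {u, v}) \<inter> p ` pverts G = {p u, p v}"
      unfolding im using ends[OF uv] by (auto simp: p_def dest: parabola_chord_hits_parabola)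
    ultimately show ?case by (simp add: e)
  next
    case (3 e)
    obtain u v where e: "e = (u, v)" by (cases e)
    have ordered: "closed_segment (p u) (p v) \<inter> closed_segment (p x) (p y) \<subseteq> p ` ({u, v} \<inter> {x, y})"
      if uv: "(u, v) \<in> parcs G" "(x, y) \<in> parcs G" and ne: "{u, v} \<noteq> {x, y}" and lt: "f u < f v" "f x < f y" for u v x y
    proof
      fix z assume z: "z \<in> closed_segment (p u) (p v) \<inter> closed_segment (p x) (p y)"
      have "(f u, f v) \<noteq> (f x, f y)"
        using ne ends[OF uv(1)] ends[OF uv(2)] inj by (auto dest: inj_onD)
      then obtain t where t: "t \<in> {f u, f v} \<inter> {f x, f y}" "z = parabola t"
        using parabola_chords_meet[of z "f u" "f v" "f x" "f y"] z lt nc[OF uv] nc[OF uv(2,1)] unfolding p_def by auto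
      obtain s where s: "s \<in> {u, v}" "t = f s" using t by auto
      obtain r where r: "r \<in> {x, y}" "t = f r" using t by auto
      have "s = r" using s r ends[OF uv(1)] ends[OF uv(2)] inj by (auto dest: inj_onD)
      then show "z \<in> p ` ({u, v} \<inter> {x, y})" using s r t by (auto simp: p_def)
    qed
    have "closed_segment (p u) (p v) \<inter> closed_segment (p x) (p y) \<subseteq> p ` ({u, v} \<inter> {x, y})"
      if xy: "(x, y) \<in> parcs G" "{u, v} \<noteq> {x, y}" for x y
    proof -
      have uv: "(u, v) \<in> parcs G" "(x, y) \<in> parcs G" using 3 e xy by simp_all
      have vu: "(v, u) \<in> parcs G" "(y, x) \<in> parcs G" using uv basic(4) by auto
      consider "f u < f v" "f x < f y" | "f v < f u" "f x < f y" | "f u < f v" "f y < f x" | "f v < f u" "f y < f x"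
        using ends[OF uv(1)] ends[OF uv(2)] by linarith
      then show ?thesis
        using ordered[of u v x y] ordered[of v u x y] ordered[of u v y x] ordered[of v u y x] uv vu xy(2)
        by cases (simp_all add: insert_commute closed_segment_commute)
    qed
    then show ?case unfolding e im by blast
  qed
  moreover have "p ` pverts G \<subseteq> frontier (outside (drawing_image G p c))"
  proof
    let ?K = "{z. (Re z)\<^sup>2 \<le> Im z}"
    fix z assume "z \<in> p ` pverts G"
    then obtain v where v: "v \<in> pverts G" "z = p v" by auto
    have pK: "p w \<in> ?K" for w by (simp add: p_def parabola_def)
    have "drawing_image G p c \<subseteq> ?K"
      unfolding drawing_image_def using pK closed_segment_subset[OF pK pK convex_parabola_region] by (auto simp: im)
    then have out: "- ?K \<subseteq> outside (drawing_image G p c)"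
      using outside_mono outside_convex[OF convex_parabola_region] by blast
    have "z \<in> closure (- ?K)"
    proof (rule closure_approachable[THEN iffD2], intro allI impI)
      fix e :: real assume "0 < e"
      have "Complex (f v) ((f v)\<^sup>2 - e / 2) \<in> - ?K" using \<open>0 < e\<close> by simp
      moreover have "dist (Complex (f v) ((f v)\<^sup>2 - e / 2)) z < e"
        unfolding v(2) p_def parabola_def using \<open>0 < e\<close> by (simp add: dist_norm cmod_def)
      ultimately show "\<exists>y \<in> - ?K. dist y z < e" by blast
    qed
    then have "z \<in> closure (outside (drawing_image G p c))" using closure_mono[OF out] by blast
    moreover have "z \<in> drawing_image G p c" using v by (simp add: drawing_image_def)
    then have "z \<notin> outside (drawing_image G p c)" using outside_no_overlap[of "drawing_image G p c"] by blast
    then have "z \<notin> interior (outside (drawing_image G p c))" using interior_subset by blast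
    ultimately show "z \<in> frontier (outside (drawing_image G p c))" by (simp add: frontier_def)
  qed
  ultimately show ?thesis using G unfolding outerplanar_def by blast
qed

text \<open>
  Any order of the vertices works, as all edges share an end.
\<close>
lemma outerplanar_star:
  assumes G: "pair_graph G" and z: "adjacency.star (parcs G) (pverts G) z"
  shows "outerplanar G"
proof -
  interpret A: adjacency "parcs G" using G by (rule adjacency_parcs)
  have fin: "finite (pverts G)" and sub: "parcs G \<inter> pverts G \<times> pverts G = parcs G"
  proof -
    interpret pair_graph G by (rule G)
    show "finite (pverts G)" by (rule pair_finite_verts)
    show "parcs G \<inter> pverts G \<times> pverts G = parcs G" by (auto dest: in_arcsD1 in_arcsD2)
  qed
  have z: "x = z \<or> y = z" if "(x, y) \<in> parcs G" for x y
    using z that unfolding A.star_def sub by auto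
  obtain g :: "'a \<Rightarrow> nat" where g: "inj_on g (pverts G)"
    using finite_imp_inj_to_nat_seg[OF fin] by blast
  show ?thesis
  proof (rule outerplanar_if_noncrossing[OF G])
    show "inj_on (\<lambda>v. real (g v)) (pverts G)" using g by (simp add: inj_on_def)
    show "\<not> (real (g u) < real (g x) \<and> real (g x) < real (g v) \<and> real (g v) < real (g y))"
      if "(u, v) \<in> parcs G" "(x, y) \<in> parcs G" for u v x y
      using z[OF that(1)] z[OF that(2)] by auto
  qed
qed

text \<open>
  The positions in the list serve as the order along the parabola.
\<close>
lemma outerplanar_induced:
  assumes G: "pair_graph G" and ind: "adjacency.induced (parcs G) (pverts G) xs ((\<lambda>(i, j). (xs ! i, xs ! j)) ` F)"
    and F: "F \<subseteq> {..<length xs} \<times> {..<length xs}"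
    and nc: "\<forall>(i, j) \<in> F \<union> F\<inverse>. \<forall>(k, l) \<in> F \<union> F\<inverse>. \<not> (i < k \<and> k < j \<and> j < l)"
  shows "outerplanar G"
proof -
  interpret A: adjacency "parcs G" using G by (rule adjacency_parcs)
  have sub: "parcs G \<inter> pverts G \<times> pverts G = parcs G"
  proof -
    interpret pair_graph G by (rule G)
    show ?thesis by (auto dest: in_arcsD1 in_arcsD2)
  qed
  have xs: "distinct xs" "pverts G = set xs"
    and E: "parcs G = (\<lambda>(i, j). (xs ! i, xs ! j)) ` F \<union> ((\<lambda>(i, j). (xs ! i, xs ! j)) ` F)\<inverse>"
    using ind unfolding A.induced_def sub by auto
  define f where "f = inv_into {..<length xs} ((!) xs)"
  have inj: "inj_on ((!) xs) {..<length xs}" using xs(1) by (simp add: inj_on_nth)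
  have im: "(!) xs ` {..<length xs} = set xs" by (auto simp: set_conv_nth)
  have ff: "f (xs ! i) = i" if "i < length xs" for i using inj that by (simp add: f_def)
  have injf: "inj_on f (pverts G)"
    unfolding xs(2) im[symmetric] f_def by (rule inj_on_inv_into) simp
  have edge: "(f u, f v) \<in> F \<union> F\<inverse>" if "(u, v) \<in> parcs G" for u v
    using that F ff unfolding E by auto
  show ?thesis
  proof (rule outerplanar_if_noncrossing[OF G])
    show "inj_on (\<lambda>v. real (f v)) (pverts G)" using injf by (simp add: inj_on_def)
    show "\<not> (real (f u) < real (f x) \<and> real (f x) < real (f v) \<and> real (f v) < real (f y))"
      if "(u, v) \<in> parcs G" "(x, y) \<in> parcs G" for u v x y
      using bspec[OF bspec[OF nc edge[OF that(1)], simplified] edge[OF that(2)]] by simp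
  qed
qed

section \<open>The extremal numbers\<close>

lemma is_star_iff:
  assumes "2 \<le> n"
  shows "is_star n G \<longleftrightarrow> pair_graph G \<and> card (pverts G) = n \<and> (\<exists>z. adjacency.star (parcs G) (pverts G) z)"
    (is "?L \<longleftrightarrow> ?R")
proof
  assume ?L
  then have pg: "pair_graph G" by (rule pair_graphI_complete_bipartite)
  interpret A: adjacency "parcs G" using pg by (rule adjacency_parcs)
  obtain U V where UV: "finite (pverts G)" "pverts G = U \<union> V" "U \<inter> V = {}" "card U = 1" "card V = n - 1"
    "parcs G = U \<times> V \<union> V \<times> U"
    using \<open>?L\<close> unfolding complete_bipartite_digraph_pair_def by blast
  obtain z where z: "U = {z}" using UV(4) by (auto simp: card_1_singleton_iff)
  have V: "V = pverts G - {z}" using UV z by auto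
  have "card (pverts G) = n" using UV assms by (simp add: card_Un_disjoint)
  moreover have "A.star (pverts G) z" unfolding A.star_def using UV(2,6) z V by auto
  ultimately show ?R using pg by blast
next
  assume R: ?R
  then interpret A: adjacency "parcs G" using adjacency_parcs by blast
  obtain z where z: "A.star (pverts G) z" using R by blast
  have sub: "parcs G \<inter> pverts G \<times> pverts G = parcs G"
  proof -
    interpret pair_graph G using R by blast
    show ?thesis by (auto dest: in_arcsD1 in_arcsD2)
  qed
  have zV: "z \<in> pverts G" and E: "parcs G = {z} \<times> (pverts G - {z}) \<union> (pverts G - {z}) \<times> {z}"
    using z unfolding A.star_def sub by auto
  have fin: "finite (pverts G)" using R assms by (metis card.infinite not_numeral_le_zero)
  have "card (pverts G) = n" using R by blast
  then have cV: "card (pverts G - {z}) = n - 1" using zV fin by simp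
  have split: "pverts G = {z} \<union> (pverts G - {z})" "{z} \<inter> (pverts G - {z}) = {}" using zV by blast+
  have "card {z} = 1" by simp
  show ?L unfolding complete_bipartite_digraph_pair_def
    by (intro conjI exI[of _ "{z}"] exI[of _ "pverts G - {z}"]) fact+
qed

lemma ex_OP_eqI:
  fixes G :: "nat pair_pre_digraph"
  assumes "\<And>G :: nat pair_pre_digraph. outerplanar G \<Longrightarrow> card (pverts G) = n \<Longrightarrow> ind_copies H G \<le> m"
    and "outerplanar G" "card (pverts G) = n" "ind_copies H G = m"
  shows "ex_OP n H = m"
  unfolding ex_OP_def
proof (rule Max_eqI)
  show "finite {ind_copies H G |G :: nat pair_pre_digraph. outerplanar G \<and> card (pverts G) = n}"
    by (rule finite_subset[of _ "{..m}"]) (use assms(1) in auto)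
qed (use assms in auto)

lemma outerplanar_pair_graph: "outerplanar G \<Longrightarrow> pair_graph G"
  by (simp add: outerplanar_def)

lemma finite_pverts: "pair_graph G \<Longrightarrow> finite (pverts G)"
proof -
  assume "pair_graph G"
  then interpret pair_graph G .
  show ?thesis by (rule pair_finite_verts)
qed

lemma pverts_cycle_graph: "pverts (cycle_graph k) = {..<k}"
  by (simp add: cycle_graph_def)

lemma parcs_cycle_graph:
  "parcs (cycle_graph k) = (\<lambda>i. (i, (i + 1) mod k)) ` {..<k} \<union> ((\<lambda>i. (i, (i + 1) mod k)) ` {..<k})\<inverse>"
  by (auto simp: cycle_graph_def)

lemma pverts_insert_edge: "pverts (insert_edge u v G) = {u, v} \<union> pverts G"
  by (auto simp: insert_edge_def)

lemma parcs_insert_edge: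
  assumes "parcs G = F \<union> F\<inverse>"
  shows "parcs (insert_edge u v G) = insert (u, v) F \<union> (insert (u, v) F)\<inverse>"
  using assms by (auto simp: insert_edge_def)

lemma cycle_graph_edges:
  "(\<lambda>i. (i, (i + 1) mod 4)) ` {..<4} = {(0, 1), (1, 2), (2, 3), (3, 0 :: nat)}"
  "(\<lambda>i. (i, (i + 1) mod 5)) ` {..<5} = {(0, 1), (1, 2), (2, 3), (3, 4), (4, 0 :: nat)}"
  "(\<lambda>i. (i, (i + 1) mod 6)) ` {..<6} = {(0, 1), (1, 2), (2, 3), (3, 4), (4, 5), (5, 0 :: nat)}"
proof -
  have "{..<4} = {0, 1, 2, 3 :: nat}" by auto
  then show "(\<lambda>i. (i, (i + 1) mod 4)) ` {..<4} = {(0, 1), (1, 2), (2, 3), (3, 0 :: nat)}"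
    by (simp del: One_nat_def)
  have "{..<5} = {0, 1, 2, 3, 4 :: nat}" by auto
  then show "(\<lambda>i. (i, (i + 1) mod 5)) ` {..<5} = {(0, 1), (1, 2), (2, 3), (3, 4), (4, 0 :: nat)}"
    by (simp del: One_nat_def)
  have "{..<6} = {0, 1, 2, 3, 4, 5 :: nat}" by auto
  then show "(\<lambda>i. (i, (i + 1) mod 6)) ` {..<6} = {(0, 1), (1, 2), (2, 3), (3, 4), (4, 5), (5, 0 :: nat)}"
    by (simp del: One_nat_def)
qed

lemma graph_iso_cycle4:
  "graph_iso G (cycle_graph 4) \<longleftrightarrow> pair_graph G \<and> (\<exists>a b c d. adjacency.cycle4 (parcs G) (pverts G) a b c d)"
proof -
  let ?F = "{(0, 1), (1, 2), (2, 3), (3, 0 :: nat)}"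
  have "parcs (cycle_graph 4) = ?F \<union> ?F\<inverse>" unfolding parcs_cycle_graph cycle_graph_edges ..
  then have "graph_iso G (cycle_graph 4) \<longleftrightarrow> pair_graph G \<and>
    (\<exists>xs. length xs = 4 \<and> adjacency.induced (parcs G) (pverts G) xs ((\<lambda>(i, j). (xs ! i, xs ! j)) ` ?F))"
    by (intro graph_iso_induced pverts_cycle_graph) auto
  also have "\<dots> \<longleftrightarrow> pair_graph G \<and> (\<exists>a b c d. adjacency.cycle4 (parcs G) (pverts G) a b c d)"
    unfolding ex_list_4 by simp
  finally show ?thesis .
qed

lemma graph_iso_pan:
  "graph_iso G (insert_edge 0 4 (cycle_graph 4)) \<longleftrightarrow>
     pair_graph G \<and> (\<exists>a b c d e. adjacency.pan (parcs G) (pverts G) a b c d e)"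
proof -
  let ?F = "{(0, 4), (0, 1), (1, 2), (2, 3), (3, 0 :: nat)}"
  have "parcs (insert_edge 0 4 (cycle_graph 4)) = ?F \<union> ?F\<inverse>"
    by (intro parcs_insert_edge) (simp only: parcs_cycle_graph cycle_graph_edges)
  moreover have "pverts (insert_edge 0 4 (cycle_graph 4)) = {..<5}"
    by (auto simp: pverts_insert_edge pverts_cycle_graph)
  ultimately have "graph_iso G (insert_edge 0 4 (cycle_graph 4)) \<longleftrightarrow> pair_graph G \<and>
    (\<exists>xs. length xs = 5 \<and> adjacency.induced (parcs G) (pverts G) xs ((\<lambda>(i, j). (xs ! i, xs ! j)) ` ?F))"
    by (intro graph_iso_induced) auto
  also have "\<dots> \<longleftrightarrow> pair_graph G \<and> (\<exists>a b c d e. adjacency.pan (parcs G) (pverts G) a b c d e)"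
    unfolding ex_list_5 by (simp add: insert_commute)
  finally show ?thesis .
qed

lemma graph_iso_house:
  "graph_iso G (insert_edge 0 2 (cycle_graph 5)) \<longleftrightarrow>
     pair_graph G \<and> (\<exists>a b c d e. adjacency.house (parcs G) (pverts G) a b c d e)"
proof -
  let ?F = "{(0, 2), (0, 1), (1, 2), (2, 3), (3, 4), (4, 0 :: nat)}"
  have "parcs (insert_edge 0 2 (cycle_graph 5)) = ?F \<union> ?F\<inverse>"
    by (intro parcs_insert_edge) (simp only: parcs_cycle_graph cycle_graph_edges)
  moreover have "pverts (insert_edge 0 2 (cycle_graph 5)) = {..<5}"
    by (auto simp: pverts_insert_edge pverts_cycle_graph)
  ultimately have "graph_iso G (insert_edge 0 2 (cycle_graph 5)) \<longleftrightarrow> pair_graph G \<and>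
    (\<exists>xs. length xs = 5 \<and> adjacency.induced (parcs G) (pverts G) xs ((\<lambda>(i, j). (xs ! i, xs ! j)) ` ?F))"
    by (intro graph_iso_induced) auto
  also have "\<dots> \<longleftrightarrow> pair_graph G \<and> (\<exists>a b c d e. adjacency.house (parcs G) (pverts G) a b c d e)"
    unfolding ex_list_5 by (simp add: insert_commute)
  finally show ?thesis .
qed

lemma graph_iso_chorded_hexagon:
  "graph_iso G (insert_edge 0 3 (cycle_graph 6)) \<longleftrightarrow>
     pair_graph G \<and> (\<exists>a b c d e f. adjacency.chorded_hexagon (parcs G) (pverts G) a b c d e f)"
proof -
  let ?F = "{(0, 3), (0, 1), (1, 2), (2, 3), (3, 4), (4, 5), (5, 0 :: nat)}"
  have "parcs (insert_edge 0 3 (cycle_graph 6)) = ?F \<union> ?F\<inverse>"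
    by (intro parcs_insert_edge) (simp only: parcs_cycle_graph cycle_graph_edges)
  moreover have "pverts (insert_edge 0 3 (cycle_graph 6)) = {..<6}"
    by (auto simp: pverts_insert_edge pverts_cycle_graph)
  ultimately have "graph_iso G (insert_edge 0 3 (cycle_graph 6)) \<longleftrightarrow> pair_graph G \<and>
    (\<exists>xs. length xs = 6 \<and> adjacency.induced (parcs G) (pverts G) xs ((\<lambda>(i, j). (xs ! i, xs ! j)) ` ?F))"
    by (intro graph_iso_induced) auto
  also have "\<dots> \<longleftrightarrow> pair_graph G \<and> (\<exists>a b c d e f. adjacency.chorded_hexagon (parcs G) (pverts G) a b c d e f)"
    unfolding ex_list_6 by (simp add: insert_commute)
  finally show ?thesis .
qed

lemma graph_iso_refl:
  assumes "parcs G \<subseteq> pverts G \<times> pverts G" shows "graph_iso G G"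
proof -
  have "pair_wf_digraph G" using assms by unfold_locales auto
  then show ?thesis unfolding graph_iso_iff by (intro conjI exI[of _ id]) (auto simp: prod.map_id0)
qed

lemma graph_iso_refl_cycle_graph: "graph_iso (cycle_graph k) (cycle_graph k)"
  by (rule graph_iso_refl) (auto simp: cycle_graph_def)

lemma graph_iso_refl_insert_edge_cycle_graph:
  "graph_iso (insert_edge u v (cycle_graph k)) (insert_edge u v (cycle_graph k))"
  by (rule graph_iso_refl) (auto simp: cycle_graph_def insert_edge_def)

lemma cycle4_outerplanar_count:
  assumes "graph_iso G (cycle_graph 4)"
  shows "outerplanar G" "card (pverts G) = 4" "ind_copies (path_graph 3) G = 4"
proof -
  obtain a b c d where G: "pair_graph G" and cyc: "adjacency.cycle4 (parcs G) (pverts G) a b c d"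
    using assms unfolding graph_iso_cycle4 by blast
  interpret A: adjacency "parcs G" using G by (rule adjacency_parcs)
  show "outerplanar G"
    by (rule outerplanar_induced[OF G, of "[a, b, c, d]" "{(0, 1), (1, 2), (2, 3), (3, 0)}"]) (use cyc in auto)
  show "card (pverts G) = 4"
    using distinct_card[OF A.induced_distinct[OF cyc]] A.induced_set[OF cyc] by simp
  show "ind_copies (path_graph 3) G = 4"
    using ind_copies_path3[OF G] A.card_P3s_cycle4[OF cyc] by simp
qed

lemma pan_outerplanar_count:
  assumes "graph_iso G (insert_edge 0 4 (cycle_graph 4))"
  shows "outerplanar G" "card (pverts G) = 5" "ind_copies (path_graph 3) G = 6"
proof -
  obtain a b c d e where G: "pair_graph G" and pan: "adjacency.pan (parcs G) (pverts G) a b c d e"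
    using assms unfolding graph_iso_pan by blast
  interpret A: adjacency "parcs G" using G by (rule adjacency_parcs)
  show "outerplanar G"
    by (rule outerplanar_induced[OF G, of "[a, b, c, d, e]" "{(0, 1), (1, 2), (2, 3), (3, 0), (0, 4)}"])
      (use pan in auto)
  show "card (pverts G) = 5"
    using distinct_card[OF A.induced_distinct[OF pan]] A.induced_set[OF pan] by simp
  show "ind_copies (path_graph 3) G = 6"
    using ind_copies_path3[OF G] A.card_P3s_pan[OF pan] by simp
qed

lemma house_outerplanar_count:
  assumes "graph_iso G (insert_edge 0 2 (cycle_graph 5))"
  shows "outerplanar G" "card (pverts G) = 5" "ind_copies (path_graph 3) G = 6"
proof -
  obtain a b c d e where G: "pair_graph G" and house: "adjacency.house (parcs G) (pverts G) a b c d e"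
    using assms unfolding graph_iso_house by blast
  interpret A: adjacency "parcs G" using G by (rule adjacency_parcs)
  show "outerplanar G"
    by (rule outerplanar_induced[OF G, of "[a, b, c, d, e]" "{(0, 1), (1, 2), (2, 3), (3, 4), (4, 0), (0, 2)}"])
      (use house in auto)
  show "card (pverts G) = 5"
    using distinct_card[OF A.induced_distinct[OF house]] A.induced_set[OF house] by simp
  show "ind_copies (path_graph 3) G = 6"
    using ind_copies_path3[OF G] A.card_P3s_house[OF house] by simp
qed

lemma chorded_hexagon_outerplanar_count:
  assumes "graph_iso G (insert_edge 0 3 (cycle_graph 6))"
  shows "outerplanar G" "card (pverts G) = 6" "ind_copies (path_graph 3) G = 10"
proof -
  obtain a b c d e f where G: "pair_graph G" and hex: "adjacency.chorded_hexagon (parcs G) (pverts G) a b c d e f"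
    using assms unfolding graph_iso_chorded_hexagon by blast
  interpret A: adjacency "parcs G" using G by (rule adjacency_parcs)
  show "outerplanar G"
    by (rule outerplanar_induced[OF G, of "[a, b, c, d, e, f]" "{(0, 1), (1, 2), (2, 3), (3, 4), (4, 5), (5, 0), (0, 3)}"])
      (use hex in auto)
  show "card (pverts G) = 6"
    using distinct_card[OF A.induced_distinct[OF hex]] A.induced_set[OF hex] by simp
  show "ind_copies (path_graph 3) G = 10"
    using ind_copies_path3[OF G] A.card_P3s_chorded_hexagon[OF hex] by simp
qed

lemma star_outerplanar_count:
  assumes "2 \<le> n" "is_star n G"
  shows "outerplanar G" "card (pverts G) = n" "ind_copies (path_graph 3) G = (n - 1) choose 2"
proof -
  obtain z where G: "pair_graph G" "card (pverts G) = n" and z: "adjacency.star (parcs G) (pverts G) z"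
    using assms is_star_iff by blast
  show "outerplanar G" using G(1) z by (rule outerplanar_star)
  show "card (pverts G) = n" by (rule G(2))
  show "ind_copies (path_graph 3) G = (n - 1) choose 2"
    using ind_copies_path3[OF G(1)] adjacency.card_P3s_star[OF adjacency_parcs[OF G(1)] z finite_pverts[OF G(1)]] G(2)
    by simp
qed

lemma ex_star: "\<exists>G :: nat pair_pre_digraph. is_star (Suc n) G"
proof
  show "is_star (Suc n) \<lparr>pverts = {..n}, parcs = {0} \<times> {0<..n} \<union> {0<..n} \<times> {0}\<rparr>"
    unfolding complete_bipartite_digraph_pair_def
    by (intro conjI exI[of _ "{0}"] exI[of _ "{0<..n}"]) auto
qed

lemma ind_copies_path3_le:
  assumes "outerplanar G" "5 \<le> card (pverts G)"
  shows "ind_copies (path_graph 3) G \<le> (card (pverts G) - 1) choose 2"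
  using outerplanar_adjacency.card_P3s_le[OF outerplanar_adjacency_parcs[OF assms(1)] finite_pverts assms(2)]
    ind_copies_path3 outerplanar_pair_graph[OF assms(1)] by metis

lemma ex_OP_path3:
  assumes "5 \<le> n"
  shows "ex_OP n (path_graph 3) = (n - 1) choose 2"
proof -
  obtain G :: "nat pair_pre_digraph" where "is_star n G" using ex_star[of "n - 1"] assms by auto
  then have G: "outerplanar G" "card (pverts G) = n" "ind_copies (path_graph 3) G = (n - 1) choose 2"
    using star_outerplanar_count[of n G] assms by simp_all
  show ?thesis
  proof (rule ex_OP_eqI[OF _ G])
    fix G' :: "nat pair_pre_digraph" assume "outerplanar G'" "card (pverts G') = n"
    then show "ind_copies (path_graph 3) G' \<le> (n - 1) choose 2" using ind_copies_path3_le[of G'] assms by simp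
  qed
qed

lemma ex_OP_4: "ex_OP 4 (path_graph 3) = 4"
proof (rule ex_OP_eqI)
  fix G :: "nat pair_pre_digraph"
  assume G: "outerplanar G" "card (pverts G) = 4"
  then show "ind_copies (path_graph 3) G \<le> 4"
    using adjacency.four_vertices(1)[OF adjacency_parcs] ind_copies_path3 outerplanar_pair_graph by metis
qed (use cycle4_outerplanar_count[OF graph_iso_refl_cycle_graph] in auto)

theorem theorem1p1:
  shows "(\<forall>n\<ge>7. ex_OP n (path_graph 3) = (n - 1) choose 2 \<and>
           (\<forall>G :: 'a pair_pre_digraph. outerplanar G \<and> card (pverts G) = n \<and>
              ind_copies (path_graph 3) G = (n - 1) choose 2 \<longrightarrow> is_star n G)) \<and>
         (ex_OP 4 (path_graph 3) = 4 \<and> ind_copies (path_graph 3) (cycle_graph 4) = 4 \<and>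
           (\<forall>G :: 'a pair_pre_digraph. extremal 4 G \<longleftrightarrow> graph_iso G (cycle_graph 4))) \<and>
         (ex_OP 5 (path_graph 3) = 6 \<and>
           ind_copies (path_graph 3) (insert_edge 0 4 (cycle_graph 4)) = 6 \<and>
           (\<forall>G :: 'a pair_pre_digraph. extremal 5 G \<longleftrightarrow>
              graph_iso G (insert_edge 0 4 (cycle_graph 4)) \<or>
              graph_iso G (insert_edge 0 2 (cycle_graph 5)) \<or> is_star 5 G)) \<and>
         (ex_OP 6 (path_graph 3) = 10 \<and>
           ind_copies (path_graph 3) (insert_edge 0 3 (cycle_graph 6)) = 10 \<and>
           (\<forall>G :: 'a pair_pre_digraph. is_star 6 G \<longrightarrow> ind_copies (path_graph 3) G = 10) \<and>
           (\<forall>G :: 'a pair_pre_digraph. extremal 6 G \<longleftrightarrow>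
              is_star 6 G \<or> graph_iso G (insert_edge 0 3 (cycle_graph 6))))"
proof (intro conjI)
  show "\<forall>n\<ge>7. ex_OP n (path_graph 3) = (n - 1) choose 2 \<and>
           (\<forall>G :: 'a pair_pre_digraph. outerplanar G \<and> card (pverts G) = n \<and>
              ind_copies (path_graph 3) G = (n - 1) choose 2 \<longrightarrow> is_star n G)"
  proof (intro allI impI conjI)
    fix n :: nat assume n: "7 \<le> n"
    then show "ex_OP n (path_graph 3) = (n - 1) choose 2" by (intro ex_OP_path3) simp
    fix G :: "'a pair_pre_digraph"
    assume G: "outerplanar G \<and> card (pverts G) = n \<and> ind_copies (path_graph 3) G = (n - 1) choose 2"
    then have pg: "pair_graph G" by (simp add: outerplanar_pair_graph)
    have "\<exists>z. adjacency.star (parcs G) (pverts G) z"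
      using outerplanar_adjacency.extremal_star[OF outerplanar_adjacency_parcs, of G "pverts G"] G n ind_copies_path3[OF pg]
      by simp
    then show "is_star n G" using is_star_iff[of n G] n pg G by simp
  qed
next
  show ex4: "ex_OP 4 (path_graph 3) = 4" by (rule ex_OP_4)
  show "ind_copies (path_graph 3) (cycle_graph 4) = 4"
    by (rule cycle4_outerplanar_count[OF graph_iso_refl_cycle_graph])
  show "\<forall>G :: 'a pair_pre_digraph. extremal 4 G \<longleftrightarrow> graph_iso G (cycle_graph 4)"
  proof (intro allI iffI)
    fix G :: "'a pair_pre_digraph" assume "extremal 4 G"
    then have G: "outerplanar G" "card (pverts G) = 4" "ind_copies (path_graph 3) G = 4"
      by (auto simp: extremal_def ex4)
    then have pg: "pair_graph G" by (simp add: outerplanar_pair_graph)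
    then show "graph_iso G (cycle_graph 4)"
      using adjacency.four_vertices(2)[OF adjacency_parcs[OF pg] G(2)] G(3) ind_copies_path3[OF pg]
      by (simp add: graph_iso_cycle4)
  next
    fix G :: "'a pair_pre_digraph" assume "graph_iso G (cycle_graph 4)"
    from cycle4_outerplanar_count[OF this] show "extremal 4 G" by (simp add: extremal_def ex4)
  qed
next
  show ex5: "ex_OP 5 (path_graph 3) = 6" using ex_OP_path3[of 5] by (simp add: choose_two)
  show "ind_copies (path_graph 3) (insert_edge 0 4 (cycle_graph 4)) = 6"
    by (rule pan_outerplanar_count[OF graph_iso_refl_insert_edge_cycle_graph])
  show "\<forall>G :: 'a pair_pre_digraph. extremal 5 G \<longleftrightarrow>
              graph_iso G (insert_edge 0 4 (cycle_graph 4)) \<or>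
              graph_iso G (insert_edge 0 2 (cycle_graph 5)) \<or> is_star 5 G"
  proof (intro allI iffI)
    fix G :: "'a pair_pre_digraph" assume "extremal 5 G"
    then have G: "outerplanar G" "card (pverts G) = 5" "ind_copies (path_graph 3) G = 6"
      by (auto simp: extremal_def ex5)
    then have pg: "pair_graph G" by (simp add: outerplanar_pair_graph)
    have "card (adjacency.P3s (parcs G) (pverts G)) = 6" using G(3) ind_copies_path3[OF pg] by simp
    from outerplanar_adjacency.five_vertices(2)[OF outerplanar_adjacency_parcs[OF G(1)] G(2) this]
    show "graph_iso G (insert_edge 0 4 (cycle_graph 4)) \<or> graph_iso G (insert_edge 0 2 (cycle_graph 5)) \<or> is_star 5 G"
      using pg G(2) is_star_iff[of 5 G] unfolding graph_iso_pan graph_iso_house by simp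
  next
    fix G :: "'a pair_pre_digraph"
    assume "graph_iso G (insert_edge 0 4 (cycle_graph 4)) \<or> graph_iso G (insert_edge 0 2 (cycle_graph 5)) \<or> is_star 5 G"
    then show "extremal 5 G"
    proof (elim disjE)
      assume "graph_iso G (insert_edge 0 4 (cycle_graph 4))"
      from pan_outerplanar_count[OF this] show ?thesis by (simp add: extremal_def ex5)
    next
      assume "graph_iso G (insert_edge 0 2 (cycle_graph 5))"
      from house_outerplanar_count[OF this] show ?thesis by (simp add: extremal_def ex5)
    next
      assume "is_star 5 G"
      from star_outerplanar_count[OF _ this] show ?thesis by (simp add: extremal_def ex5 choose_two)
    qed
  qed
next
  show ex6: "ex_OP 6 (path_graph 3) = 10" using ex_OP_path3[of 6] by (simp add: choose_two)
  show "ind_copies (path_graph 3) (insert_edge 0 3 (cycle_graph 6)) = 10"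
    by (rule chorded_hexagon_outerplanar_count[OF graph_iso_refl_insert_edge_cycle_graph])
  show star6: "\<forall>G :: 'a pair_pre_digraph. is_star 6 G \<longrightarrow> ind_copies (path_graph 3) G = 10"
    using star_outerplanar_count(3)[of 6] by (auto simp: choose_two)
  show "\<forall>G :: 'a pair_pre_digraph. extremal 6 G \<longleftrightarrow>
              is_star 6 G \<or> graph_iso G (insert_edge 0 3 (cycle_graph 6))"
  proof (intro allI iffI)
    fix G :: "'a pair_pre_digraph" assume "extremal 6 G"
    then have G: "outerplanar G" "card (pverts G) = 6" "ind_copies (path_graph 3) G = 10"
      by (auto simp: extremal_def ex6)
    then have pg: "pair_graph G" by (simp add: outerplanar_pair_graph)
    have "card (adjacency.P3s (parcs G) (pverts G)) = 10" using G(3) ind_copies_path3[OF pg] by simp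
    from outerplanar_adjacency.extremal_six[OF outerplanar_adjacency_parcs[OF G(1)] G(2) this]
    show "is_star 6 G \<or> graph_iso G (insert_edge 0 3 (cycle_graph 6))"
      using pg G(2) is_star_iff[of 6 G] unfolding graph_iso_chorded_hexagon by simp
  next
    fix G :: "'a pair_pre_digraph"
    assume "is_star 6 G \<or> graph_iso G (insert_edge 0 3 (cycle_graph 6))"
    then show "extremal 6 G"
    proof (elim disjE)
      assume star: "is_star 6 G"
      from star_outerplanar_count[OF _ this] show ?thesis by (simp add: extremal_def ex6 choose_two)
    next
      assume "graph_iso G (insert_edge 0 3 (cycle_graph 6))"
      from chorded_hexagon_outerplanar_count[OF this] show ?thesis by (simp add: extremal_def ex6)
    qed
  qed
qed

end
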